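(* Let $A(n)$ be the number of distinct squares occurring in the prefix $\mathbb{T}[1,n]$ of the Tribonacci sequence $\mathbb{T}$, and let $t_m$ be the Tribonacci numbers with $t_{-2}=0$, $t_{-1}=t_0=1$, $t_m=t_{m-1}+t_{m-2}+t_{m-3}$ for $m\ge 1$. For $m\ge 4$ put $\alpha_m=2t_{m-1}$, $\beta_m=t_m+2t_{m-3}-1$, $\gamma_m=2t_m-t_{m-1}$, $\theta_m=\frac{3t_m+t_{m-2}-3}{2}$. Then $A(n)=0$ for $n\le 7$; $A(n)=1$ for $n=8,9$; $A(n)=2$ for $10\le n\le 13$. For $n\ge 14$, let $m$ be the integer such that $2t_{m-1}\le n<2t_m$ (that is, $\alpha_m\le n<\alpha_{m+1}$); then $m\ge 4$ and $$A(n)=\begin{cases} n-\frac12(t_m+t_{m-3}+m+3), & \alpha_m\le n<\beta_m;\\ \frac12(t_{m-1}+t_{m-2}+4t_{m-3}-m-5), & \beta_m\le n<\gamma_m;\\ n-\frac12(t_{m-1}+3t_{m-2}+m+3), & \gamma_m\le n<\theta_m;\\ \frac12(2t_{m-1}+t_{m-2}+3t_{m-3}-m-6), & \theta_m\le n<\alpha_{m+1}. \end{cases}$$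
   Context: The Tribonacci sequence $\mathbb{T}$ is the infinite word over $\{a,b,c\}$ that is the fixed point beginning with $a$ of the substitution $\sigma(a)=ab$, $\sigma(b)=ac$, $\sigma(c)=a$. Letters are indexed from $1$, and $\mathbb{T}[1,n]$ denotes the prefix of $\mathbb{T}$ of length $n$. The notation $u\prec v$ means that $u$ is a factor (contiguous subword) of $v$. The number of distinct squares is $A(n)=\sharp\{\omega : \omega \text{ a nonempty finite word},\ \omega\omega\prec\mathbb{T}[1,n]\}$. *)

theory Defs
  imports Complex_Main "HOL-Library.Stream" "HOL-Library.Sublist"
begin

section \<open>The Tribonacci word\<close>

datatype letter = La | Lb | Lc

fun trib_subst :: "letter \<Rightarrow> letter list" where
  "trib_subst La = [La, Lb]"
| "trib_subst Lb = [La, Lc]"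
| "trib_subst Lc = [La]"

text \<open>Since no letter has an empty image, \<^const>\<open>flat\<close> really concatenates the images of
  the letters of an infinite word.\<close>

definition trib_subst_inf :: "letter stream \<Rightarrow> letter stream" where
  "trib_subst_inf w = flat (smap trib_subst w)"

definition tribonacci_word :: "letter stream" where
  "tribonacci_word = (THE w. shd w = La \<and> trib_subst_inf w = w)"

text \<open>The following lemmas show that this definite description is well-defined.\<close>

lemma trib_subst_nonempty: "trib_subst x \<noteq> []"
  by (cases x) auto

lemma trib_subst_inf_shift:
  "trib_subst_inf (xs @- w) = concat (map trib_subst xs) @- trib_subst_inf w"
proof (induction xs)
  case (Cons x xs)
  then show ?case
    using flat_unfold[of "smap trib_subst ((x # xs) @- w)"]
    by (simp add: trib_subst_inf_def trib_subst_nonempty)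
qed simp

lemma length_concat_trib_subst:
  "length xs \<le> length (concat (map trib_subst xs))"
  "xs \<noteq> [] \<Longrightarrow> hd xs = La \<Longrightarrow> Suc (length xs) \<le> length (concat (map trib_subst xs))"
proof -
  show *: "length xs \<le> length (concat (map trib_subst xs))" for xs
  proof (induction xs)
    case (Cons x xs)
    then show ?case by (cases x) auto
  qed simp
  show "xs \<noteq> [] \<Longrightarrow> hd xs = La \<Longrightarrow> Suc (length xs) \<le> length (concat (map trib_subst xs))"
    using *[of "tl xs"] by (cases xs) auto
qed

lemma trib_fixed_point_unique:
  assumes "shd v = La" "trib_subst_inf v = v" "shd w = La" "trib_subst_inf w = w"
  shows "v = w"
proof -
  have "stake (Suc n) v = stake (Suc n) w" for n
  proof (induction n)
    case 0
    then show ?case using assms by simp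
  next
    case (Suc n)
    define xs where "xs = stake (Suc n) v"
    define ys where "ys = concat (map trib_subst xs)"
    have "xs \<noteq> []" "hd xs = La" "length xs = Suc n"
      using assms(1) by (simp_all add: xs_def)
    then have len: "Suc (Suc n) \<le> length ys"
      using length_concat_trib_subst(2)[of xs] by (simp add: ys_def)
    have "v = ys @- trib_subst_inf (sdrop (Suc n) v)"
      using trib_subst_inf_shift[of xs "sdrop (Suc n) v"] assms(2)
      unfolding xs_def ys_def stake_sdrop by simp
    moreover have "w = ys @- trib_subst_inf (sdrop (Suc n) w)"
      using trib_subst_inf_shift[of xs "sdrop (Suc n) w"] assms(4)
      unfolding xs_def ys_def Suc.IH stake_sdrop by simp
    ultimately show ?case
      using len by (metis stake_shift diff_is_0_eq stake.simps(1) append_Nil2)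
  qed
  then have "v !! n = w !! n" for n
    by (metis lessI stake_nth)
  then have "snth v = snth w"
    by (rule ext)
  then show ?thesis
    by (metis stream_smap_nats)
qed

lemma trib_fixed_point_exists: "\<exists>w. shd w = La \<and> trib_subst_inf w = w"
proof -
  define W where "W k = ((\<lambda>xs. concat (map trib_subst xs)) ^^ k) [La]" for k
  have W_0: "W 0 = [La]" and W_Suc: "W (Suc k) = concat (map trib_subst (W k))" for k
    by (simp_all add: W_def)
  have step: "prefix (W k) (W (Suc k))" for k
  proof (induction k)
    case (Suc k)
    then show ?case
      by (metis W_Suc concat_append map_append prefix_def)
  qed (simp add: W_Suc W_0)
  have mono: "prefix (W k) (W l)" if "k \<le> l" for k l
    using that by (induction rule: dec_induct) (use step prefix_order.order_trans in blast)+
  have hd_W: "W k \<noteq> [] \<and> hd (W k) = La" for k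
    using mono[of 0 k] by (auto simp: W_0 prefix_def)
  have len: "k < length (W k)" for k
  proof (induction k)
    case (Suc k)
    then show ?case
      using length_concat_trib_subst(2)[of "W k"] hd_W[of k] by (simp add: W_Suc)
  qed (simp add: W_0)
  define w where "w = smap (\<lambda>i. W i ! i) nats"
  have w_nth: "w !! i = W k ! i" if "i < length (W k)" for i k
  proof -
    have "W i ! i = W k ! i"
      using mono[of i k] mono[of k i] that len[of i]
      by (cases "i \<le> k") (auto simp: prefix_def nth_append)
    then show ?thesis by (simp add: w_def)
  qed
  have stake_w: "stake (length (W k)) w = W k" for k
    by (rule nth_equalityI) (simp_all add: w_nth)
  have "trib_subst_inf w !! i = w !! i" for i
  proof -
    have "trib_subst_inf w = W (Suc i) @- trib_subst_inf (sdrop (length (W i)) w)"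
      using trib_subst_inf_shift[of "W i" "sdrop (length (W i)) w"]
      by (metis W_Suc stake_sdrop stake_w)
    moreover have "i < length (W (Suc i))"
      using len[of "Suc i"] by simp
    ultimately show ?thesis
      using w_nth[of i "Suc i"] by (simp add: shift_snth)
  qed
  then have "snth (trib_subst_inf w) = snth w"
    by (rule ext)
  then have "trib_subst_inf w = w"
    by (metis stream_smap_nats)
  moreover have "shd w = La"
    using w_nth[of 0 0] by (simp add: W_0)
  ultimately show ?thesis by blast
qed

lemma tribonacci_word_fixed_point:
  "shd tribonacci_word = La" "trib_subst_inf tribonacci_word = tribonacci_word"
proof -
  have "\<exists>!w. shd w = La \<and> trib_subst_inf w = w"
    using trib_fixed_point_exists trib_fixed_point_unique by blast
  from theI'[OF this] show "shd tribonacci_word = La"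
    "trib_subst_inf tribonacci_word = tribonacci_word"
    by (simp_all add: tribonacci_word_def)
qed


section \<open>Distinct squares in prefixes\<close>

text \<open>The prefix of length \<open>n\<close> is \<open>stake n tribonacci_word\<close>, and \<^const>\<open>sublist\<close> is the
  contiguous factor relation. The set below is finite, since its elements are themselves
  factors of that prefix.\<close>

definition num_squares :: "nat \<Rightarrow> nat" where
  "num_squares n = card {\<omega>. \<omega> \<noteq> [] \<and> sublist (\<omega> @ \<omega>) (stake n tribonacci_word)}"

lemma finite_squares:
  "finite {\<omega>. \<omega> \<noteq> [] \<and> sublist (\<omega> @ \<omega>) (stake n tribonacci_word)}"
proof (rule finite_subset)
  show "{\<omega>. \<omega> \<noteq> [] \<and> sublist (\<omega> @ \<omega>) (stake n tribonacci_word)}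
    \<subseteq> set (sublists (stake n tribonacci_word))"
    using sublist_order.order_trans[OF sublist_append_rightI] by auto
qed simp


section \<open>Tribonacci numbers\<close>

text \<open>Indices start at \<open>-2\<close>; values at smaller indices are a convention without meaning.\<close>

function trib :: "int \<Rightarrow> int" where
  "trib m =
    (if m \<le> -2 then 0 else if m \<le> 0 then 1
     else trib (m - 1) + trib (m - 2) + trib (m - 3))"
  by auto
termination by (relation "measure (\<lambda>m. nat (m + 2))") auto

declare trib.simps [simp del]

lemma trib_rec:
  "trib (-2) = 0" "trib (-1) = 1" "trib 0 = 1"
  "m \<ge> 1 \<Longrightarrow> trib m = trib (m - 1) + trib (m - 2) + trib (m - 3)"
  by (simp_all add: trib.simps[of "-2"] trib.simps[of "-1"] trib.simps[of 0] trib.simps[of m])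

text \<open>The thresholds are real-valued so that the division in \<open>trib_theta\<close> is exact.\<close>

definition trib_alpha :: "int \<Rightarrow> real" where
  "trib_alpha m = 2 * trib (m - 1)"

definition trib_beta :: "int \<Rightarrow> real" where
  "trib_beta m = trib m + 2 * trib (m - 3) - 1"

definition trib_gamma :: "int \<Rightarrow> real" where
  "trib_gamma m = 2 * trib m - trib (m - 1)"

definition trib_theta :: "int \<Rightarrow> real" where
  "trib_theta m = (3 * trib m + trib (m - 2) - 3) / 2"

end

theory Submission
  imports Defs
begin

text \<open>Let \<open>T\<close> be the Tribonacci word, indexed from \<open>0\<close>, and let \<open>\<Phi> i\<close> be the position at which the
  \<open>\<sigma>\<close>-image of the letter \<open>T i\<close> starts in \<open>T = \<sigma>(T)\<close>. A square with period \<open>p\<close> at \<open>s\<close> lies in a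
  unique maximal stretch \<open>s' \<le> x < r\<close> on which \<open>T x = T (x + p)\<close>; it is recorded as the run
  \<open>(s', q, r)\<close> with \<open>q = s' + p\<close>, and it contains squares exactly at the starts
  \<open>s', \<dots>, s' + (r - q)\<close> if \<open>q \<le> r\<close>.

  The three images \<open>ab\<close>, \<open>ac\<close>, \<open>a\<close> begin with the same letter \<open>a\<close>, and each is followed by, or ends
  with, a letter that tells it apart from the others. Hence \<open>\<sigma>\<close> sends a run \<open>(s, q, r)\<close> exactly to the
  run \<open>(\<Phi> s, \<Phi> q, \<Phi> r + 1)\<close>: nothing is gained on the left, one letter is gained on the right.
  Conversely, a nonempty run starts with the letter \<open>a\<close> and is such an image. If \<open>q \<le> r + 1\<close>,
  the same holds for the preimage because \<open>cc\<close> does not occur, so descent ends at an empty run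
  \<open>(i, i + 1, i)\<close>, a seed. Every square therefore lies in a run
  \<open>(\<Phi>\<^sup>k i, \<Phi>\<^sup>k (i + 1), \<Psi>\<^sup>k i)\<close> with \<open>\<Psi> x = \<Phi> x + 1\<close>; this is \<open>run_from_seed\<close>. Its period is
  \<open>|\<sigma>\<^sup>k(T i)|\<close>, and by \<open>run_end\<close> it contains squares only from \<open>k = 3, 2, 1\<close> on when \<open>T i\<close> is
  \<open>a, b, c\<close>; \<open>n\<close> steps later the excess \<open>r - q\<close> is \<open>\<epsilon> n = t\<^sub>0 + \<dots> + t\<^sub>n\<^sub>-\<^sub>1\<close>.

  The word of such a square depends only on \<open>T i\<close>, \<open>k\<close> and the offset in the run, so
  the first occurrences come from the first letters \<open>a, b, c\<close>, at the positions \<open>0, 1, 3\<close>.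
  The periods are \<open>t\<^sub>k\<close> for the seeds \<open>a\<close> and \<open>c\<close>, and \<open>t\<^sub>k\<^sub>+\<^sub>1 + t\<^sub>k\<close> for the seed \<open>b\<close>. A run with seed
  \<open>c\<close> contains all conjugates of its root; the run with seed \<open>a\<close> of the same period contains
  fewer of them, but starts at \<open>0\<close>. Different conjugates are different words because the roots
  are primitive, which in turn follows from the absence of fourth powers, as \<open>\<epsilon> n\<close> is always less
  than twice the period. Thus every square gets an explicit first end (\<open>squares_in_prefix\<close>), and \<open>A(n)\<close>
  is the number of these ends up to \<open>n\<close>.

  From \<open>\<alpha>\<^sub>m\<close> up to \<open>\<alpha>\<^sub>m\<^sub>+\<^sub>1 - 1\<close> the first ends form two intervals, and each position in them is
  the first end of exactly one square. The interval from \<open>\<alpha>\<^sub>m\<close> to \<open>\<beta>\<^sub>m\<close> consists of the first ends of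
  the period \<open>t\<^sub>m\<^sub>-\<^sub>1\<close> that come from the seed \<open>a\<close> and, immediately after them, of those of the period
  \<open>t\<^sub>m\<^sub>-\<^sub>3\<close> that had to wait for the seed \<open>c\<close>. The interval from \<open>\<gamma>\<^sub>m\<close> to \<open>\<theta>\<^sub>m\<close> consists of the first
  ends of the period \<open>t\<^sub>m\<^sub>-\<^sub>2 + t\<^sub>m\<^sub>-\<^sub>3\<close>.\<close>

section \<open>Block decomposition of the Tribonacci word\<close>

definition T :: "nat \<Rightarrow> letter" where
  "T i = tribonacci_word !! i"

definition block_start :: "nat \<Rightarrow> nat" (\<open>\<Phi>\<close>) where
  "\<Phi> i = length (concat (map trib_subst (stake i tribonacci_word)))"

text \<open>The letter that follows the leading \<open>a\<close> of the image of a letter; after the image \<open>a\<close> of \<open>c\<close> this is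
  the leading \<open>a\<close> of the next block. It is also the last letter of the image. Being injective, it decides at
  both ends of a run whether two blocks agree.\<close>

fun next_letter :: "letter \<Rightarrow> letter" where
  "next_letter La = Lb"
| "next_letter Lb = Lc"
| "next_letter Lc = La"

lemma next_letter_inject [simp]: "next_letter x = next_letter y \<longleftrightarrow> x = y"
  by (cases x; cases y) simp_all

lemma tribonacci_word_from_block:
  "tribonacci_word !! (\<Phi> i + j) = trib_subst_inf (sdrop i tribonacci_word) !! j"
proof -
  have "tribonacci_word = trib_subst_inf (stake i tribonacci_word @- sdrop i tribonacci_word)"
    by (simp add: stake_sdrop tribonacci_word_fixed_point(2))
  then have "tribonacci_word = concat (map trib_subst (stake i tribonacci_word))
      @- trib_subst_inf (sdrop i tribonacci_word)"
    by (simp only: trib_subst_inf_shift)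
  then show ?thesis
    unfolding block_start_def by (metis shift_snth_ge le_add1 diff_add_inverse)
qed

lemma trib_subst_inf_SCons: "trib_subst_inf (x ## w) = trib_subst x @- trib_subst_inf w"
  using trib_subst_inf_shift[of "[x]" w] by simp

lemma trib_subst_inf_0: "trib_subst_inf w !! 0 = La"
  by (cases w; cases "shd w") (auto simp: trib_subst_inf_SCons)

lemma T_block_start [simp]: "T (\<Phi> i) = La"
  using tribonacci_word_from_block[of i 0] by (simp only: T_def trib_subst_inf_0 add_0_right)

lemma T_after_block_start [simp]: "T (Suc (\<Phi> i)) = next_letter (T i)"
proof -
  have "sdrop i tribonacci_word = T i ## sdrop (Suc i) tribonacci_word"
    unfolding T_def by (metis sdrop_simps(1) sdrop_simps(2) stream.collapse)
  then have "T (Suc (\<Phi> i)) =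
      (trib_subst (T i) @- trib_subst_inf (sdrop (Suc i) tribonacci_word)) !! 1"
    using tribonacci_word_from_block[of i 1] by (simp add: T_def trib_subst_inf_SCons)
  then show ?thesis
    using trib_subst_inf_0[of "sdrop (Suc i) tribonacci_word"]
    by (cases "T i") (simp_all add: shift_snth)
qed

lemma block_start_0 [simp]: "\<Phi> 0 = 0"
  by (simp add: block_start_def)

lemma block_start_Suc: "\<Phi> (Suc i) = (if T i = Lc then Suc (\<Phi> i) else Suc (Suc (\<Phi> i)))"
  by (cases "T i") (simp_all add: block_start_def T_def stake_Suc del: stake.simps)

lemma strict_mono_block_start: "strict_mono \<Phi>"
  by (simp add: strict_mono_Suc_iff block_start_Suc)

lemma block_start_less_iff [simp]: "\<Phi> i < \<Phi> j \<longleftrightarrow> i < j"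
  by (rule strict_mono_less[OF strict_mono_block_start])

lemma block_start_le_iff [simp]: "\<Phi> i \<le> \<Phi> j \<longleftrightarrow> i \<le> j"
  by (rule strict_mono_less_eq[OF strict_mono_block_start])

lemma block_start_add_ge: "\<Phi> i + n \<le> \<Phi> (i + n)"
  by (induction n) (auto simp: block_start_Suc)

text \<open>Blocks have length one or two, so a position that is not a block start is the second position of
  a block, whose letter is then \<open>a\<close> or \<open>b\<close>.\<close>

lemma position_in_block:
  obtains i where "n = \<Phi> i" | i where "n = Suc (\<Phi> i)" "T i \<noteq> Lc"
proof -
  have "(\<exists>i. n = \<Phi> i) \<or> (\<exists>i. n = Suc (\<Phi> i) \<and> T i \<noteq> Lc)"
  proof (induction n)
    case 0
    then show ?case using block_start_0 by metis
  next
    case (Suc n)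
    then show ?case using block_start_Suc by metis
  qed
  then show thesis using that by blast
qed

lemma T_eq_La_iff: "T n = La \<longleftrightarrow> (\<exists>i. n = \<Phi> i)"
proof
  assume n: "T n = La"
  show "\<exists>i. n = \<Phi> i"
  proof (cases n rule: position_in_block)
    case (2 i)
    then show ?thesis using n by (cases "T i") auto
  qed auto
qed auto

lemma T_after_non_La: "T n \<noteq> La \<Longrightarrow> T (Suc n) = La"
proof (cases n rule: position_in_block)
  case (2 i)
  then have "Suc n = \<Phi> (Suc i)" by (simp add: block_start_Suc)
  then show ?thesis by (simp only: T_block_start)
qed simp

text \<open>Two consecutive blocks have total length at least three since \<open>cc\<close> is not a factor. This keeps the
  deficiency of a run from growing under desubstitution.\<close>

lemma block_start_add_2: "\<Phi> i + 3 \<le> \<Phi> (Suc (Suc i))"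
  using T_after_non_La[of i] by (auto simp: block_start_Suc)

lemma T_initial: "T 0 = La" "T 1 = Lb" "T 2 = La" "T 3 = Lc" "T 4 = La" "T 5 = Lb" "T 6 = La"
  and block_start_initial: "\<Phi> 1 = 2" "\<Phi> 2 = 4" "\<Phi> 3 = 6" "\<Phi> 4 = 7"
proof -
  show 0: "T 0 = La" by (metis T_block_start block_start_0)
  show p1: "\<Phi> 1 = 2" using block_start_Suc[of 0] 0 by simp
  show 1: "T 1 = Lb" by (metis 0 One_nat_def T_after_block_start block_start_0 next_letter.simps(1))
  show p2: "\<Phi> 2 = 4" using block_start_Suc[of 1] 1 p1 by (simp add: numeral_eq_Suc)
  show 2: "T 2 = La" by (metis p1 T_block_start)
  have "Suc (\<Phi> 1) = 3" "Suc (\<Phi> 2) = 5" using p1 p2 by simp_all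
  then show 3: "T 3 = Lc" and "T 5 = Lb"
    by (metis 1 T_after_block_start next_letter.simps(2))
       (metis 2 \<open>Suc (\<Phi> 2) = 5\<close> T_after_block_start next_letter.simps(1))
  show "T 4 = La" by (metis p2 T_block_start)
  show p3: "\<Phi> 3 = 6" using block_start_Suc[of 2] 2 p2 by (simp add: numeral_eq_Suc)
  show "T 6 = La" by (metis p3 T_block_start)
  show "\<Phi> 4 = 7" using block_start_Suc[of 3] 3 p3 by (simp add: numeral_eq_Suc)
qed

lemma block_start_greater: "0 < n \<Longrightarrow> n < \<Phi> n"
proof (induction n)
  case (Suc n)
  then show ?case
    by (cases "n = 0") (auto simp: block_start_Suc T_initial)
qed simp

section \<open>The substitution acting on equal factors\<close>

definition agree :: "nat \<Rightarrow> nat \<Rightarrow> nat \<Rightarrow> bool" where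
  "agree x y L \<longleftrightarrow> (\<forall>j<L. T (x + j) = T (y + j))"

lemma agree_mono: "agree x y L \<Longrightarrow> L' \<le> L \<Longrightarrow> agree x y L'"
  by (auto simp: agree_def)

lemma agree_Suc: "agree x y (Suc L) \<longleftrightarrow> agree x y L \<and> T (x + L) = T (y + L)"
  by (auto simp: agree_def less_Suc_eq)

lemma agree_block_start_add: "agree x y L \<Longrightarrow> \<Phi> (x + L) + \<Phi> y = \<Phi> (y + L) + \<Phi> x"
  by (induction L) (auto simp: agree_Suc block_start_Suc)

text \<open>The additional letter at the end is the leading \<open>a\<close> common to the images of all letters.\<close>

lemma agree_block_start: "agree x y L \<Longrightarrow> agree (\<Phi> x) (\<Phi> y) (Suc (\<Phi> (x + L) - \<Phi> x))"
proof (induction L)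
  case 0
  then show ?case by (simp add: agree_def)
next
  case (Suc L)
  then have IH: "agree (\<Phi> x) (\<Phi> y) (Suc (\<Phi> (x + L) - \<Phi> x))"
    and eq: "T (x + L) = T (y + L)" and L: "agree x y L" by (auto simp: agree_Suc)
  define d where "d = \<Phi> (x + L) - \<Phi> x"
  have d: "\<Phi> (x + L) = \<Phi> x + d" "\<Phi> (y + L) = \<Phi> y + d"
    using agree_block_start_add[OF L] block_start_le_iff[of x "x + L"]
    by (auto simp: d_def simp del: block_start_le_iff)
  have next_eq: "T (\<Phi> x + Suc d) = T (\<Phi> y + Suc d)"
    using T_after_block_start[of "x + L"] T_after_block_start[of "y + L"] eq d by simp
  show ?case
  proof (cases "T (x + L) = Lc")
    case True
    then have "\<Phi> (x + Suc L) - \<Phi> x = Suc d" using d by (simp add: block_start_Suc)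
    then show ?thesis
      using IH next_eq by (simp only: agree_Suc d_def)
  next
    case False
    then have "T (\<Phi> x + Suc (Suc d)) = T (\<Phi> y + Suc (Suc d))"
      using T_block_start[of "Suc (x + L)"] T_block_start[of "Suc (y + L)"] d eq
      by (simp add: block_start_Suc)
    moreover have "\<Phi> (x + Suc L) - \<Phi> x = Suc (Suc d)"
      using d False by (simp add: block_start_Suc)
    ultimately show ?thesis
      using IH next_eq by (simp only: agree_Suc d_def)
  qed
qed

lemma agree_block_start_funpow:
  "agree x y L \<Longrightarrow> (\<Phi>^^k) (x + L) + (\<Phi>^^k) y = (\<Phi>^^k) (y + L) + (\<Phi>^^k) x
    \<and> agree ((\<Phi>^^k) x) ((\<Phi>^^k) y) ((\<Phi>^^k) (x + L) - (\<Phi>^^k) x)"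
proof (induction k)
  case (Suc k)
  have "(\<Phi>^^k) x \<le> (\<Phi>^^k) (x + L)"
    by (induction k) auto
  then obtain d where d: "(\<Phi>^^k) (x + L) = (\<Phi>^^k) x + d"
    using le_Suc_ex by blast
  then have d': "(\<Phi>^^k) (y + L) = (\<Phi>^^k) y + d" and ag: "agree ((\<Phi>^^k) x) ((\<Phi>^^k) y) d"
    using Suc by auto
  show ?case
    using agree_block_start[OF ag] agree_block_start_add[OF ag] d d'
    by (auto simp: agree_Suc)
qed simp


section \<open>Every run comes from a seed\<close>

text \<open>The maximal stretch \<open>s \<le> x < r\<close> on which the word agrees with its shift by the period \<open>q - s\<close>. Keeping
  \<open>q\<close> instead of the period makes the action of the substitution uniform, and allowing the
  empty stretch \<open>r = s\<close> is what lets the descent end in seeds.\<close>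

definition run :: "nat \<Rightarrow> nat \<Rightarrow> nat \<Rightarrow> bool" where
  "run s q r \<longleftrightarrow> s < q \<and> s \<le> r \<and> agree s q (r - s) \<and> T r \<noteq> T (r - s + q)
     \<and> (s = 0 \<or> T (s - 1) \<noteq> T (q - 1))"

lemma first_mismatch:
  assumes "\<not> agree x y M"
  obtains L where "L < M" "agree x y L" "T (x + L) \<noteq> T (y + L)"
proof -
  let ?P = "\<lambda>j. T (x + j) \<noteq> T (y + j)"
  obtain j where j: "j < M" "?P j" using assms by (auto simp: agree_def)
  then have "?P (LEAST j. ?P j)" "(LEAST j. ?P j) \<le> j"
    using LeastI[of ?P] Least_le[of ?P] by blast+
  moreover have "agree x y (LEAST j. ?P j)"
    using not_less_Least by (auto simp: agree_def)
  ultimately show thesis using that[of "LEAST j. ?P j"] j(1) by linarith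
qed

text \<open>The common first letter of the two factors is \<open>a\<close>: a second letter of a block would determine its
  predecessor, and the run would extend to the left. So both factors start with blocks, and the
  first disagreement of the preimages is carried to the disagreement at \<open>r\<close>.\<close>

lemma run_desubstitute:
  assumes "run s q r" "s < r"
  obtains s' q' r' where "run s' q' r'" "s = \<Phi> s'" "q = \<Phi> q'" "r = Suc (\<Phi> r')"
proof -
  have sq: "s < q" and ag: "agree s q (r - s)" and mis: "T r \<noteq> T (r - s + q)"
    and left: "s = 0 \<or> T (s - 1) \<noteq> T (q - 1)"
    using assms by (auto simp: run_def)
  have eq: "T s = T q" using ag assms(2) by (auto simp: agree_def dest: spec[of _ 0])
  have "T s = La"
  proof (rule ccontr)
    assume non: "T s \<noteq> La"
    then have "s \<noteq> 0" using T_initial by metis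
    obtain i where i: "s = Suc (\<Phi> i)" using non by (cases s rule: position_in_block) auto
    obtain j where j: "q = Suc (\<Phi> j)" using non eq by (cases q rule: position_in_block) auto
    show False using left i j by simp
  qed
  then obtain s' q' where s': "s = \<Phi> s'" and q': "q = \<Phi> q'"
    using eq T_eq_La_iff by metis
  \<comment> \<open>Images are at least as long as preimages, so the preimages disagree within \<open>r - s\<close> letters.\<close>
  have "\<not> agree s' q' (r - s)"
  proof
    assume "agree s' q' (r - s)"
    then have "agree s q (Suc (\<Phi> (s' + (r - s)) - \<Phi> s'))"
      using agree_block_start s' q' by blast
    moreover have "r - s < Suc (\<Phi> (s' + (r - s)) - \<Phi> s')"
      using block_start_add_ge[of s' "r - s"] by linarith
    ultimately have "T (s + (r - s)) = T (q + (r - s))" unfolding agree_def by blast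
    then show False using mis assms(2) by (simp add: add.commute)
  qed
  then obtain L where L: "agree s' q' L" "T (s' + L) \<noteq> T (q' + L)"
    by (rule first_mismatch)
  define d where "d = \<Phi> (s' + L) - \<Phi> s'"
  have d: "\<Phi> (s' + L) = \<Phi> s' + d" "\<Phi> (q' + L) = \<Phi> q' + d"
    using agree_block_start_add[OF L(1)] block_start_le_iff[of s' "s' + L"]
    by (auto simp: d_def simp del: block_start_le_iff)
  have ag': "agree s q (Suc d)"
    using agree_block_start[OF L(1)] by (simp add: s' q' d_def)
  have mis': "T (s + Suc d) \<noteq> T (q + Suc d)"
    using T_after_block_start[of "s' + L"] T_after_block_start[of "q' + L"] L(2) d s' q' by simp
  have "r - s = Suc d"
  proof (rule linorder_cases)
    assume "r - s < Suc d"
    then have "T (s + (r - s)) = T (q + (r - s))" using ag' by (simp add: agree_def)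
    then show ?thesis using mis assms(2) by (simp add: add.commute)
  next
    assume "Suc d < r - s"
    then show ?thesis using ag mis' unfolding agree_def by blast
  qed
  then have r: "r = Suc (\<Phi> (s' + L))" using d s' assms(2) by simp
  have "s' = 0 \<or> T (s' - 1) \<noteq> T (q' - 1)"
  proof (rule ccontr)
    assume "\<not> ?thesis"
    then have s0: "s' \<noteq> 0" and eq': "T (s' - 1) = T (q' - 1)" by auto
    have q0: "q' \<noteq> 0" using sq s' q' by (cases "q' = 0") auto
    have pred: "T (\<Phi> n - 1) = next_letter (T (n - 1))" if "n \<noteq> 0" for n
      using that block_start_Suc[of "n - 1"] T_block_start[of "n - 1"]
      by (cases "T (n - 1)") auto
    have "T (s - 1) = T (q - 1)" using pred[OF s0] pred[OF q0] eq' s' q' by simp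
    moreover have "s \<noteq> 0" using s0 s' block_start_less_iff[of 0 s'] by simp
    ultimately show False using left by blast
  qed
  then have "run s' q' (s' + L)"
    using sq L s' q' by (auto simp: run_def add.commute)
  then show thesis using that s' q' r by blast
qed

text \<open>The map \<open>\<Psi>\<close> moves the end of a run under the substitution.\<close>

abbreviation block_second :: "nat \<Rightarrow> nat" (\<open>\<Psi>\<close>) where
  "\<Psi> i \<equiv> Suc (\<Phi> i)"

text \<open>Descent on \<open>q\<close>. The hypothesis admits runs that miss a square by one letter, since the preimage of a
  run with excess zero may be one letter too short; two letters too short is impossible because
  two blocks have length at least three.\<close>

theorem run_from_seed:
  assumes "run s q r" "q \<le> Suc r"
  obtains i k where "s = (\<Phi>^^k) i" "q = (\<Phi>^^k) (Suc i)" "r = (\<Psi>^^k) i"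
proof -
  from assms have "\<exists>i k. s = (\<Phi>^^k) i \<and> q = (\<Phi>^^k) (Suc i) \<and> r = (\<Psi>^^k) i"
  proof (induction q arbitrary: s r rule: less_induct)
    case (less q)
    show ?case
    proof (cases "s < r")
      case False
      then have "s = r" "q = Suc s" using less.prems by (auto simp: run_def)
      then show ?thesis by (intro exI[of _ s] exI[of _ 0]) simp
    next
      case True
      then obtain s' q' r' where *: "run s' q' r'" "s = \<Phi> s'" "q = \<Phi> q'" "r = \<Psi> r'"
        using run_desubstitute less.prems(1) by blast
      have "q' < q" using * block_start_greater[of q'] by (simp add: run_def)
      moreover have "q' \<le> Suc r'"
      proof (rule ccontr)
        assume "\<not> q' \<le> Suc r'"
        then have "\<Phi> (Suc (Suc r')) \<le> \<Phi> q'" by simp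
        then show False using block_start_add_2[of r'] less.prems(2) * by linarith
      qed
      ultimately obtain i k where
        "s' = (\<Phi>^^k) i \<and> q' = (\<Phi>^^k) (Suc i) \<and> r' = (\<Psi>^^k) i"
        using less.IH *(1) by blast
      then show ?thesis using * by (intro exI[of _ i] exI[of _ "Suc k"]) simp
    qed
  qed
  then show thesis using that by blast
qed

text \<open>A period of a tail would desubstitute to a period of a tail of the preimage. Starting the preimage
  at an \<open>a\<close>, whose block has length two, makes the new period strictly smaller.\<close>

lemma not_eventually_periodic: "0 < p \<Longrightarrow> \<exists>L. \<not> agree s (s + p) L"
proof (induction p arbitrary: s rule: less_induct)
  case (less p)
  show ?case
  proof (rule ccontr)
    assume "\<not> ?thesis"
    then have per: "T (s + j) = T (s + p + j)" for j
      by (auto simp: agree_def)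
    define x where "x = \<Phi> (Suc s)"
    have xs: "s \<le> \<Phi> x"
      using block_start_greater[of "Suc s"] block_start_greater[of x] unfolding x_def by linarith
    have "T (\<Phi> x + p) = La"
      using per[of "\<Phi> x - s"] xs by (simp add: algebra_simps)
    then obtain y where y: "\<Phi> x + p = \<Phi> y" using T_eq_La_iff by blast
    have "x < y" using y less.prems block_start_less_iff[of x y] by (simp del: block_start_less_iff)
    moreover have "y - x < p"
    proof -
      have "\<Phi> (Suc x) + (y - Suc x) \<le> \<Phi> y"
        using block_start_add_ge[of "Suc x" "y - Suc x"] \<open>x < y\<close> by simp
      moreover have "T x = La" unfolding x_def by (rule T_block_start)
      then have "\<Phi> (Suc x) = \<Phi> x + 2" by (simp add: block_start_Suc)
      ultimately show ?thesis using y \<open>x < y\<close> by linarith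
    qed
    ultimately obtain L where "\<not> agree x (x + (y - x)) L"
      using less.IH[of "y - x" x] by auto
    then have "\<not> agree x y L" using \<open>x < y\<close> by simp
    then obtain M where M: "agree x y M" "T (x + M) \<noteq> T (y + M)"
      by (rule first_mismatch)
    have "T (\<Psi> (x + M)) = T (\<Psi> (x + M) + p)"
    proof -
      have "s \<le> \<Psi> (x + M)" using xs block_start_le_iff[of x "x + M"] by linarith
      then show ?thesis using per[of "\<Psi> (x + M) - s"] by (simp add: algebra_simps)
    qed
    moreover have "\<Phi> (x + M) + p = \<Phi> (y + M)"
      using agree_block_start_add[OF M(1)] y by linarith
    ultimately have "T (\<Psi> (x + M)) = T (\<Psi> (y + M))" by simp
    then show False using M(2) by simp
  qed
qed

lemma extend_to_run:
  assumes "agree s (s + p) L" "0 < p"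
  obtains s' r where "run s' (s' + p) r" "s' \<le> s" "s + L \<le> r"
proof -
  define P where "P s' \<longleftrightarrow> s' \<le> s \<and> agree s' (s' + p) (s - s')" for s'
  have "P s" by (simp add: P_def agree_def)
  define s' where "s' = (LEAST x. P x)"
  have P: "P s'" unfolding s'_def by (rule LeastI) fact
  have left: "s' = 0 \<or> T (s' - 1) \<noteq> T (s' + p - 1)"
  proof (rule ccontr)
    assume "\<not> ?thesis"
    then obtain s'' where s'': "s' = Suc s''" "T s'' = T (s'' + p)"
      by (cases s') auto
    have "agree s'' (s'' + p) (s - s'')"
      unfolding agree_def
    proof (intro allI impI)
      fix j assume j: "j < s - s''"
      show "T (s'' + j) = T (s'' + p + j)"
      proof (cases j)
        case (Suc i)
        then have "T (s' + i) = T (s' + p + i)"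
          using P j s'' by (auto simp: P_def agree_def)
        then show ?thesis using Suc s'' by simp
      qed (simp add: s'')
    qed
    then have "P s''" using P s'' by (simp add: P_def)
    then show False using not_less_Least[of s'' P] s'' by (simp add: s'_def)
  qed
  obtain M where "\<not> agree s' (s' + p) M" using not_eventually_periodic assms(2) by blast
  then obtain K where K: "agree s' (s' + p) K" "T (s' + K) \<noteq> T (s' + p + K)"
    by (rule first_mismatch)
  have "s + L \<le> s' + K"
  proof (rule ccontr)
    assume "\<not> ?thesis"
    then have lt: "s' + K < s + L" by simp
    have "T (s' + K) = T (s' + p + K)"
    proof (cases "s' + K < s")
      case True
      then show ?thesis using P by (auto simp: P_def agree_def)
    next
      case False
      then have "s' + K - s < L" using lt by simp
      then have "T (s + (s' + K - s)) = T (s + p + (s' + K - s))"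
        using assms(1) by (auto simp: agree_def)
      then show ?thesis using False by (simp add: algebra_simps)
    qed
    then show False using K(2) by simp
  qed
  moreover have "run s' (s' + p) (s' + K)"
    using K left assms(2) by (simp add: run_def algebra_simps)
  ultimately show thesis using that P by (auto simp: P_def)
qed


section \<open>Tribonacci lengths and excesses\<close>

definition tau :: "nat \<Rightarrow> nat" (\<open>\<tau>\<close>) where
  "\<tau> k = (\<Phi>^^k) 1"

text \<open>It turns out that \<open>\<epsilon> n\<close> is the excess \<open>r - q\<close> of a run, counted from the moment at which it is \<open>0\<close>.\<close>

definition excess :: "nat \<Rightarrow> nat" (\<open>\<epsilon>\<close>) where
  "\<epsilon> n = (\<Psi>^^n) 0"

lemma funpow_block_start_0 [simp]: "(\<Phi>^^k) 0 = 0"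
  by (induction k) simp_all

lemma funpow_block_start_less_iff [simp]: "(\<Phi>^^k) i < (\<Phi>^^k) j \<longleftrightarrow> i < j"
  by (induction k) simp_all

lemma funpow_block_start_le_iff [simp]: "(\<Phi>^^k) i \<le> (\<Phi>^^k) j \<longleftrightarrow> i \<le> j"
  by (induction k) simp_all

lemma funpow_block_start_add_prefix:
  "agree x 0 L \<Longrightarrow> (\<Phi>^^k) (x + L) = (\<Phi>^^k) x + (\<Phi>^^k) L"
  using agree_block_start_funpow[of x 0 L k] by simp

text \<open>The prefixes of length \<open>2\<close>, \<open>4\<close> and \<open>7\<close> are the iterated images of \<open>a\<close>. The lengths \<open>3\<close> and \<open>6\<close> come
  from \<open>ab\<cdot>a\<close> and \<open>abac\<cdot>ab\<close>.\<close>

lemma funpow_block_start_initial: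
  "(\<Phi>^^k) 1 = \<tau> k" "(\<Phi>^^k) 2 = \<tau> (Suc k)" "(\<Phi>^^k) 3 = \<tau> (Suc k) + \<tau> k"
  "(\<Phi>^^k) 4 = \<tau> (Suc (Suc k))" "(\<Phi>^^k) 6 = \<tau> (Suc (Suc k)) + \<tau> (Suc k)"
  "(\<Phi>^^k) 7 = \<tau> (Suc (Suc (Suc k)))"
proof -
  show 1: "(\<Phi>^^k) 1 = \<tau> k" by (simp add: tau_def)
  show 2: "(\<Phi>^^k) 2 = \<tau> (Suc k)" for k
    using funpow_swap1[of \<Phi> k 1] by (simp add: tau_def block_start_initial[simplified])
  show 4: "(\<Phi>^^k) 4 = \<tau> (Suc (Suc k))" for k
    using 2[of "Suc k"] funpow_swap1[of \<Phi> k 2] by (simp add: block_start_initial)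
  show "(\<Phi>^^k) 7 = \<tau> (Suc (Suc (Suc k)))"
    using 4[of "Suc k"] funpow_swap1[of \<Phi> k 4] by (simp add: block_start_initial)
  show "(\<Phi>^^k) 3 = \<tau> (Suc k) + \<tau> k"
    using funpow_block_start_add_prefix[of 2 1 k] 1 2 by (simp add: agree_def T_initial)
  have "agree 4 0 2"
    using T_initial by (auto simp: agree_def less_Suc_eq numeral_2_eq_2)
  then show "(\<Phi>^^k) 6 = \<tau> (Suc (Suc k)) + \<tau> (Suc k)"
    using funpow_block_start_add_prefix[of 4 2 k] 4 2 by simp
qed

lemma tau_Suc3: "\<tau> (Suc (Suc (Suc k))) = \<tau> (Suc (Suc k)) + \<tau> (Suc k) + \<tau> k"
  using funpow_block_start_add_prefix[of 6 1 k] funpow_block_start_initial[of k]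
  by (simp add: agree_def T_initial)

lemma tau_0: "\<tau> 0 = 1" and tau_1: "\<tau> (Suc 0) = 2" and tau_2: "\<tau> (Suc (Suc 0)) = 4"
  using funpow_block_start_initial[of 0] by simp_all

lemma tau_strict_mono: "strict_mono \<tau>"
  unfolding strict_mono_Suc_iff
proof
  fix k show "\<tau> k < \<tau> (Suc k)"
    using funpow_block_start_less_iff[of k 1 2] funpow_block_start_initial[of k] by simp
qed

lemma tau_less_iff [simp]: "\<tau> k < \<tau> l \<longleftrightarrow> k < l"
  by (rule strict_mono_less[OF tau_strict_mono])

lemma tau_le_iff [simp]: "\<tau> k \<le> \<tau> l \<longleftrightarrow> k \<le> l"
  by (rule strict_mono_less_eq[OF tau_strict_mono])

lemma tau_greater: "k < \<tau> k"
proof (induction k)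
  case (Suc k)
  then show ?case using tau_less_iff[of k "Suc k"] by linarith
qed (simp add: tau_0)

text \<open>The letters gained at the right end always spell a prefix of the whole word, because all blocks begin with
  \<open>a\<close>. Hence the gain is the same at every position.\<close>

lemma funpow_block_second:
  "(\<Psi>^^n) y = (\<Phi>^^n) y + \<epsilon> n \<and> agree ((\<Phi>^^n) y) 0 (\<epsilon> n)"
proof (induction n)
  case 0
  show ?case by (simp add: excess_def agree_def)
next
  case (Suc n)
  have eps: "\<epsilon> (Suc n) = Suc (\<Phi> (\<epsilon> n))" by (simp add: excess_def)
  have "\<Phi> ((\<Phi>^^n) y + \<epsilon> n) = \<Phi> ((\<Phi>^^n) y) + \<Phi> (\<epsilon> n)"
    using agree_block_start_add[of "(\<Phi>^^n) y" 0 "\<epsilon> n"] Suc by simp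
  then show ?case
    using agree_block_start[of "(\<Phi>^^n) y" 0 "\<epsilon> n"] Suc by (simp add: eps)
qed

lemma excess_0: "\<epsilon> 0 = 0"
  by (simp add: excess_def)

lemma excess_Suc: "\<epsilon> (Suc n) = \<tau> n + \<epsilon> n"
  using funpow_block_second[of n 1] funpow_swap1[of \<Psi> n 0]
  by (simp add: excess_def tau_def)

text \<open>This closed form of \<open>\<epsilon> n = t\<^sub>0 + \<dots> + t\<^sub>n\<^sub>-\<^sub>1\<close> is the source of the halves in the formulas for \<open>A(n)\<close> and
  \<open>\<theta>\<^sub>m\<close>.\<close>

lemma excess_tau: "2 * \<epsilon> n + 3 + \<tau> n = \<tau> (Suc (Suc n))"
proof (induction n)
  case (Suc n)
  then show ?case by (simp add: excess_Suc tau_Suc3)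
qed (simp add: excess_0 tau_0 tau_2)

section \<open>Location and primitivity of the squares\<close>

text \<open>The number of substitution steps after which the run grown from a seed contains a square. For the
  seed \<open>c\<close> the image \<open>a\<close> is followed by \<open>a\<close>, a square with period one. The image of \<open>b\<close> leads to \<open>c\<close>,
  and the image of \<open>a\<close> to \<open>b\<close>, as the only letter by which the run is too short.\<close>

fun delay :: "letter \<Rightarrow> nat" where
  "delay La = 3"
| "delay Lb = 2"
| "delay Lc = 1"

lemma seed_step:
  assumes "T i \<noteq> Lc"
  shows "(\<Psi>^^Suc k) i = (\<Psi>^^k) (\<Psi> i)" "(\<Phi>^^Suc k) (Suc i) = (\<Phi>^^k) (Suc (\<Psi> i))"
  using assms funpow_swap1[of \<Phi> k "Suc i"] funpow_swap1[of \<Psi> k "i"]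
  by (simp_all add: block_start_Suc)

lemma run_end:
  "(k < delay (T i) \<longrightarrow> (\<Psi>^^k) i < (\<Phi>^^k) (Suc i)) \<and>
   (delay (T i) \<le> k \<longrightarrow> (\<Psi>^^k) i = (\<Phi>^^k) (Suc i) + \<epsilon> (k - delay (T i)))"
proof (induction k arbitrary: i)
  case 0
  then show ?case by (cases "T i") auto
next
  case (Suc k)
  show ?case
  proof (cases "T i = Lc")
    case True
    then have "\<Psi> i = \<Phi> (Suc i)" by (simp add: block_start_Suc)
    then show ?thesis
      using True funpow_block_second[of k "\<Phi> (Suc i)"] funpow_swap1[of \<Psi> k i]
        funpow_swap1[of \<Phi> k "Suc i"] by simp
  next
    case False
    then have "delay (T i) = Suc (delay (T (\<Psi> i)))" by (cases "T i") auto
    then show ?thesis using Suc.IH[of "\<Psi> i"] by (simp only: seed_step[OF False]) simp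
  qed
qed

lemma run_agree:
  "(\<Phi>^^k) i \<le> (\<Psi>^^k) i \<and> agree ((\<Phi>^^k) i) ((\<Phi>^^k) (Suc i)) ((\<Psi>^^k) i - (\<Phi>^^k) i)"
proof (induction k)
  case (Suc k)
  then show ?case
    using agree_block_start[of "(\<Phi>^^k) i" "(\<Phi>^^k) (Suc i)" "(\<Psi>^^k) i - (\<Phi>^^k) i"]
      le_SucI[OF iffD2[OF block_start_le_iff[of "(\<Phi>^^k) i" "(\<Psi>^^k) i"]]]
    by (simp add: Suc_diff_le)
qed (simp add: agree_def)

text \<open>Start and period of the run that the seed at \<open>i\<close> has produced \<open>n\<close> steps after it first contained a
  square.\<close>

definition seed_start :: "nat \<Rightarrow> nat \<Rightarrow> nat" where
  "seed_start i n = (\<Phi>^^(delay (T i) + n)) i"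

definition seed_period :: "nat \<Rightarrow> nat \<Rightarrow> nat" where
  "seed_period i n = (\<Phi>^^(delay (T i) + n)) (Suc i) - (\<Phi>^^(delay (T i) + n)) i"

lemma seed_end: "seed_start i n + seed_period i n = (\<Phi>^^(delay (T i) + n)) (Suc i)"
  unfolding seed_start_def seed_period_def by (simp add: less_imp_le)

lemma seed_agree:
  "agree (seed_start i n) (seed_start i n + seed_period i n) (seed_period i n + \<epsilon> n)"
  using run_agree[of "delay (T i) + n" i] run_end[of "delay (T i) + n" i]
    funpow_block_start_le_iff[of "delay (T i) + n" i "Suc i"]
  by (simp add: seed_end) (simp add: seed_start_def seed_period_def)

text \<open>The parameter \<open>e\<close> allows for powers longer than squares.\<close>

theorem square_from_seed:
  assumes "agree s (s + p) (p + e)" "0 < p"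
  obtains i n j where "p = seed_period i n" "s = seed_start i n + j" "j + e \<le> \<epsilon> n"
proof -
  obtain s' r where run: "run s' (s' + p) r" and "s' \<le> s" "s + (p + e) \<le> r"
    using extend_to_run assms by blast
  then obtain i k where s': "s' = (\<Phi>^^k) i" and q: "s' + p = (\<Phi>^^k) (Suc i)"
    and r: "r = (\<Psi>^^k) i"
    using run_from_seed[OF run] by (metis add_leD1 add_le_mono1 le_SucI le_trans add.assoc)
  have "\<not> k < delay (T i)" using run_end[of k i] q r \<open>s' \<le> s\<close> \<open>s + (p + e) \<le> r\<close> by linarith
  then obtain n where k: "k = delay (T i) + n" using le_Suc_ex not_less by blast
  have "p = seed_period i n" using s' q k by (simp add: seed_period_def)
  moreover have "s = seed_start i n + (s - s')"
    using s' k \<open>s' \<le> s\<close> by (simp add: seed_start_def)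
  moreover have "s - s' + e \<le> \<epsilon> n"
    using run_end[of k i] q r k \<open>s' \<le> s\<close> \<open>s + (p + e) \<le> r\<close> by simp
  ultimately show thesis using that by blast
qed

lemma seed_period_eq:
  "T i = La \<Longrightarrow> seed_period i n = \<tau> (n + 3)"
  "T i = Lb \<Longrightarrow> seed_period i n = \<tau> (n + 1) + \<tau> n"
  "T i = Lc \<Longrightarrow> seed_period i n = \<tau> n"
proof -
  have same: "(\<Phi>^^k) (Suc i) - (\<Phi>^^k) i = (\<Phi>^^k) (Suc i') - (\<Phi>^^k) i'"
    if "T i = T i'" for i i' k
  proof -
    have "(\<Phi>^^k) (Suc i) + (\<Phi>^^k) i' = (\<Phi>^^k) (Suc i') + (\<Phi>^^k) i"
      using agree_block_start_funpow[of i i' 1 k] that by (simp add: agree_def)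
    moreover have "(\<Phi>^^k) i \<le> (\<Phi>^^k) (Suc i)" "(\<Phi>^^k) i' \<le> (\<Phi>^^k) (Suc i')" by simp_all
    ultimately show ?thesis by linarith
  qed
  show "seed_period i n = \<tau> (n + 3)" if "T i = La"
    using same[of i 0 "3 + n"] that T_initial funpow_block_start_initial(1)[of "3 + n"]
    by (simp add: seed_period_def add.commute)
  show "seed_period i n = \<tau> (n + 1) + \<tau> n" if "T i = Lb"
    using same[of i 1 "2 + n"] that T_initial funpow_block_start_initial(1,2)[of "2 + n"]
    by (simp add: seed_period_def numeral_2_eq_2 tau_Suc3)
  show "seed_period i n = \<tau> n" if "T i = Lc"
    using same[of i 3 "Suc n"] that T_initial funpow_block_start_initial(3,4)[of "Suc n"]
    by (simp add: seed_period_def tau_Suc3 del: funpow.simps)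
qed

lemma tau_Suc_le_double: "\<tau> (Suc n) \<le> 2 * \<tau> n"
proof -
  consider "n = 0" | "n = Suc 0" | "n = Suc (Suc 0)" | m where "n = Suc (Suc (Suc m))"
    by (metis not0_implies_Suc)
  then show ?thesis by cases (simp_all add: tau_0 tau_1 tau_2 tau_Suc3)
qed

lemma excess_less: "\<epsilon> n < 2 * \<tau> n"
  using excess_tau[of n] tau_Suc_le_double[of n] tau_Suc_le_double[of "Suc n"] by linarith

lemma excess_less_period: "\<epsilon> n < 2 * seed_period i n"
proof -
  have "\<tau> n \<le> seed_period i n"
    using seed_period_eq[of i n] by (cases "T i") simp_all
  then show ?thesis using excess_less[of n] by linarith
qed

text \<open>A fourth power would be a square with excess at least twice its period.\<close>

lemma no_fourth_power: "0 < p \<Longrightarrow> \<not> agree s (s + p) (3 * p)"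
proof
  assume p: "0 < p" and "agree s (s + p) (3 * p)"
  then have "agree s (s + p) (p + 2 * p)" by simp
  then obtain i n j where "p = seed_period i n" "j + 2 * p \<le> \<epsilon> n"
    using p by (rule square_from_seed)
  then show False using excess_less_period[of n i] by simp
qed

definition factor :: "nat \<Rightarrow> nat \<Rightarrow> letter list" where
  "factor s p = map T [s..<s + p]"

lemma length_factor [simp]: "length (factor s p) = p"
  by (simp add: factor_def)

lemma nth_factor [simp]: "x < p \<Longrightarrow> factor s p ! x = T (s + x)"
  by (simp add: factor_def)

lemma factor_eq_iff: "factor s p = factor s' p \<longleftrightarrow> agree s s' p"
  by (auto simp: list_eq_iff_nth_eq agree_def)

lemma factor_rotate:
  assumes "agree s (s + p) j"
  shows "factor (s + j) p = rotate j (factor s p)"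
  using assms
proof (induction j)
  case (Suc j)
  then have IH: "factor (s + j) p = rotate j (factor s p)" and eq: "T (s + j) = T (s + j + p)"
    by (simp_all add: agree_Suc add.assoc add.commute add.left_commute)
  have "factor (s + Suc j) p = rotate1 (factor (s + j) p)"
  proof (cases p)
    case (Suc p')
    have "[s + j..<s + j + p] = (s + j) # [Suc (s + j)..<s + j + p]" using Suc by (simp add: upt_rec)
    then show ?thesis using eq Suc by (simp add: factor_def)
  qed (simp add: factor_def)
  then show ?case using IH by simp
qed simp

text \<open>If the root were equal to its rotation by \<open>d\<close>, the square would have the period \<open>d\<close> and also the period
  \<open>p - d\<close>. The smaller of the two is at most \<open>p / 2\<close>, so it would be the period of a fourth power.\<close>

lemma primitive_square:
  assumes sq: "agree s (s + p) p" and d: "0 < d" "d < p"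
  shows "rotate d (factor s p) \<noteq> factor s p"
proof
  assume "rotate d (factor s p) = factor s p"
  then have rot: "T (s + (x + d) mod p) = T (s + x)" if "x < p" for x
    using that d nth_rotate[of x "factor s p" d] by (simp add: add.commute)
  have per: "T (s + y) = T (s + y mod p)" if "y < 2 * p" for y
  proof (cases "y < p")
    case False
    then have "y - p < p" using that by simp
    then have "T (s + (y - p)) = T (s + p + (y - p))" using sq by (auto simp only: agree_def)
    moreover have "s + p + (y - p) = s + y" "y mod p = y - p"
      using False that by (simp_all add: le_mod_geq)
    ultimately show ?thesis by simp
  qed simp
  have small: False
    if "0 < c" "2 * c \<le> p" and rot: "\<And>x. x < p \<Longrightarrow> T (s + (x + c) mod p) = T (s + x)" for c
  proof -
    have "T (s + y) = T (s + c + y)" if y: "y + c < 2 * p" for y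
    proof -
      have "T (s + c + y) = T (s + (y + c) mod p)"
        using per[OF y] by (simp add: add.assoc add.commute add.left_commute)
      also have "\<dots> = T (s + (y mod p + c) mod p)" by (simp add: mod_add_left_eq)
      also have "\<dots> = T (s + y mod p)" using rot[of "y mod p"] d by simp
      also have "\<dots> = T (s + y)" using per[of y] y by simp
      finally show ?thesis by simp
    qed
    then have "agree s (s + c) (3 * c)" using that(2) by (simp add: agree_def)
    then show False using no_fourth_power[of c s] that(1) by simp
  qed
  show False
  proof (cases "2 * d \<le> p")
    case True
    then show False using small[of d] rot d by blast
  next
    case False
    have "T (s + (x + (p - d)) mod p) = T (s + x)" if x: "x < p" for x
    proof -
      have "((x + (p - d)) mod p + d) mod p = x"
        using x d by (simp add: mod_add_left_eq)
      then show ?thesis using rot[of "(x + (p - d)) mod p"] d by simp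
    qed
    moreover have "2 * (p - d) \<le> p" "0 < p - d" using False d by arith+
    ultimately show False using small[of "p - d"] by blast
  qed
qed


lemma rotate_primitive_inject:
  assumes "agree s (s + p) p" "j < p" "j' < p"
    and "rotate j (factor s p) = rotate j' (factor s p)"
  shows "j = j'"
proof -
  have less: False
    if "i < i'" "i' < p" "rotate i (factor s p) = rotate i' (factor s p)" for i i'
  proof -
    have "rotate i (rotate (i' - i) (factor s p)) = rotate i (factor s p)"
      using that by (simp add: rotate_rotate)
    moreover have "inj (rotate i :: letter list \<Rightarrow> letter list)"
      unfolding rotate_def by (rule inj_fn[OF inj_rotate1])
    ultimately have "rotate (i' - i) (factor s p) = factor s p" by (simp add: inj_eq)
    then show False using primitive_square[OF assms(1), of "i' - i"] that by simp
  qed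
  show ?thesis using less[of j j'] less[of j' j] assms by (metis linorder_neqE_nat)
qed

lemma factor_add: "factor s (p + q) = factor s p @ factor (s + p) q"
  by (simp only: factor_def add.assoc[symmetric] upt_add_eq_append[OF le_add1] map_append)

lemma stake_tribonacci_word: "stake n tribonacci_word = factor 0 n"
  by (rule nth_equalityI) (simp_all add: T_def)

lemma square_in_prefix_iff:
  "sublist (\<omega> @ \<omega>) (stake n tribonacci_word) \<longleftrightarrow>
    (\<exists>s. s + 2 * length \<omega> \<le> n \<and> agree s (s + length \<omega>) (length \<omega>) \<and> \<omega> = factor s (length \<omega>))"
proof
  assume "sublist (\<omega> @ \<omega>) (stake n tribonacci_word)"
  then obtain u v where uv: "factor 0 n = u @ \<omega> @ \<omega> @ v"
    by (auto simp: sublist_def stake_tribonacci_word)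
  define s p where "s = length u" and "p = length \<omega>"
  have n: "n = s + (p + (p + length v))"
    using arg_cong[OF uv, of length] by (simp add: s_def p_def)
  have eq: "u @ \<omega> @ \<omega> @ v = factor 0 s @ factor s p @ factor (s + p) p @ factor (s + p + p) (length v)"
    unfolding uv[symmetric] unfolding n by (simp only: factor_add add_0)
  have "\<omega> = factor s p"
    using arg_cong[OF eq, of "\<lambda>xs. take p (drop s xs)"] by (simp flip: s_def p_def)
  moreover have "\<omega> = factor (s + p) p"
    using arg_cong[OF eq, of "\<lambda>xs. take p (drop (s + p) xs)"] by (simp flip: s_def p_def)
  ultimately have "agree s (s + p) p" using factor_eq_iff[of s p "s + p"] by simp
  moreover have "s + 2 * p \<le> n" using n by simp
  ultimately show "\<exists>s. s + 2 * length \<omega> \<le> n \<and> agree s (s + length \<omega>) (length \<omega>)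
      \<and> \<omega> = factor s (length \<omega>)"
    using \<open>\<omega> = factor s p\<close> unfolding p_def by blast
next
  assume "\<exists>s. s + 2 * length \<omega> \<le> n \<and> agree s (s + length \<omega>) (length \<omega>)
      \<and> \<omega> = factor s (length \<omega>)"
  then obtain s p where s: "s + 2 * p \<le> n" and sq: "agree s (s + p) p" and w: "factor s p = \<omega>"
    by metis
  have w': "factor (s + p) p = \<omega>" using sq w factor_eq_iff[of s p "s + p"] by simp
  obtain m where n: "n = s + (p + (p + m))"
    using s by (metis add.assoc le_Suc_ex mult_2)
  have "factor 0 n = factor 0 s @ factor s p @ factor (s + p) p @ factor (s + p + p) m"
    by (simp only: n factor_add add_0)
  then have "factor 0 n = factor 0 s @ (\<omega> @ \<omega>) @ factor (s + p + p) m"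
    by (simp only: w w' append_assoc)
  then show "sublist (\<omega> @ \<omega>) (stake n tribonacci_word)"
    unfolding sublist_def stake_tribonacci_word by blast
qed

lemma tau_le_Suc_excess: "\<tau> n \<le> Suc (\<epsilon> n)"
proof (induction n)
  case (Suc n)
  then show ?case using tau_Suc_le_double[of n] by (simp add: excess_Suc)
qed (simp add: tau_0)

section \<open>Enumeration of the distinct squares\<close>

text \<open>The roots of the squares fall into conjugacy classes, one for each length \<open>t\<^sub>k\<close> (seeds \<open>a\<close> and \<open>c\<close>) and one for
  each length \<open>t\<^sub>n\<^sub>+\<^sub>1 + t\<^sub>n\<close> (seed \<open>b\<close>). The second index is the number of rotations, which is the offset of
  the square in its run.\<close>

definition single_root :: "nat \<Rightarrow> nat \<Rightarrow> letter list" where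
  "single_root k j = rotate j (factor 0 (\<tau> k))"

definition double_root :: "nat \<Rightarrow> nat \<Rightarrow> letter list" where
  "double_root n j = rotate j (factor (\<tau> (n + 2)) (\<tau> (n + 1) + \<tau> n))"

text \<open>The number of conjugates of the root of length \<open>t\<^sub>k\<close> whose squares occur in the run with the seed \<open>a\<close>, at the
  beginning of the word. This run exists only for \<open>k \<ge> 3\<close>, when it has the excess \<open>\<epsilon> (k - 3)\<close>. The other
  conjugates have to wait for the first \<open>c\<close>.\<close>

definition early_count :: "nat \<Rightarrow> nat" where
  "early_count k = (if k < 3 then 0 else Suc (\<epsilon> (k - 3)))"

definition late_end :: "nat \<Rightarrow> nat" where
  "late_end k = \<tau> (k + 2) + \<tau> (k + 1) + 2 * \<tau> k"

definition single_end :: "nat \<Rightarrow> nat \<Rightarrow> nat" where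
  "single_end k j = (if j < early_count k then 2 * \<tau> k else late_end k) + j"

definition double_end :: "nat \<Rightarrow> nat \<Rightarrow> nat" where
  "double_end n j = \<tau> (n + 2) + 2 * (\<tau> (n + 1) + \<tau> n) + j"

lemma seed_square:
  assumes "j \<le> \<epsilon> n" "s = seed_start i n + j" "p = seed_period i n"
  shows "agree s (s + p) p" "factor s p = rotate j (factor (seed_start i n) p)"
proof -
  have ag: "agree (seed_start i n) (seed_start i n + p) (p + \<epsilon> n)"
    using seed_agree assms(3) by simp
  show "agree s (s + p) p"
    unfolding agree_def
  proof (intro allI impI)
    fix x assume "x < p"
    then have "j + x < p + \<epsilon> n" using assms(1) by simp
    then have "T (seed_start i n + (j + x)) = T (seed_start i n + p + (j + x))"
      using ag by (auto simp only: agree_def)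
    then show "T (s + x) = T (s + p + x)" by (simp add: assms(2) algebra_simps)
  qed
  show "factor s p = rotate j (factor (seed_start i n) p)"
    using factor_rotate[OF agree_mono[OF ag]] assms(1,2) by simp
qed

lemma seed_word_eq:
  assumes "T i = T i'"
  shows "seed_period i n = seed_period i' n"
    and "factor (seed_start i n) (seed_period i n) = factor (seed_start i' n) (seed_period i' n)"
proof -
  show p: "seed_period i n = seed_period i' n"
    using assms seed_period_eq by (cases "T i") simp_all
  have "agree (seed_start i n) (seed_start i' n) (seed_period i n)"
    using agree_block_start_funpow[of i i' 1 "delay (T i) + n"] assms
    by (simp add: agree_def seed_start_def seed_period_def)
  then show "factor (seed_start i n) (seed_period i n) = factor (seed_start i' n) (seed_period i' n)"
    by (simp add: factor_eq_iff flip: p)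
qed

lemma seed_start_mono:
  assumes "T i = T i'" "i' \<le> i"
  shows "seed_start i' n \<le> seed_start i n"
  using assms by (simp add: seed_start_def)

text \<open>The first \<open>a\<close>, \<open>b\<close> and \<open>c\<close> are at the positions \<open>0\<close>, \<open>1\<close> and \<open>3\<close>. The last equation merges the seeds \<open>a\<close>
  and \<open>c\<close> into one conjugacy class; it holds because the image of \<open>c\<close> is \<open>a\<close>.\<close>

lemma first_seeds:
  "seed_start 0 n = 0" "seed_period 0 n = \<tau> (n + 3)"
  "seed_start 1 n = \<tau> (n + 2)" "seed_period 1 n = \<tau> (n + 1) + \<tau> n"
  "seed_start 3 n = \<tau> (n + 2) + \<tau> (n + 1)" "seed_period 3 n = \<tau> n"
  "factor (seed_start 3 n) (\<tau> n) = factor 0 (\<tau> n)"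
proof -
  show "seed_start 0 n = 0" "seed_period 0 n = \<tau> (n + 3)" "seed_period 1 n = \<tau> (n + 1) + \<tau> n"
    "seed_period 3 n = \<tau> n"
    using seed_period_eq T_initial by (auto simp: seed_start_def)
  show "seed_start 1 n = \<tau> (n + 2)"
    using funpow_block_start_initial(1)[of "n + 2"] T_initial
    by (simp add: seed_start_def add.commute)
  have 6: "seed_start 3 n = (\<Phi>^^n) 6"
    using funpow_swap1[of \<Phi> n 3] by (simp add: seed_start_def T_initial block_start_initial)
  then show "seed_start 3 n = \<tau> (n + 2) + \<tau> (n + 1)"
    using funpow_block_start_initial(5)[of n] by (simp add: numeral_2_eq_2)
  have "agree ((\<Phi>^^n) 6) 0 (\<tau> n)"
    using agree_block_start_funpow[of 6 0 1 n] T_initial funpow_block_start_initial[of n]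
    by (simp add: agree_def tau_Suc3)
  then show "factor (seed_start 3 n) (\<tau> n) = factor 0 (\<tau> n)"
    by (simp add: 6 factor_eq_iff)
qed

lemma single_root_square:
  assumes "j < \<tau> k"
  obtains s where "s + 2 * \<tau> k = single_end k j" "agree s (s + \<tau> k) (\<tau> k)" "single_root k j = factor s (\<tau> k)"
proof (cases "j < early_count k")
  case True
  then have "k \<ge> 3" by (simp add: early_count_def split: if_splits)
  then obtain n where k: "k = n + 3" using le_Suc_ex add.commute by metis
  have "j \<le> \<epsilon> n" using True k by (simp add: early_count_def)
  then show thesis
    using that[of j] seed_square[of j n j 0 "\<tau> k"] first_seeds(1,2)[of n] True k
    by (simp add: single_end_def single_root_def)
next
  case False
  have "j \<le> \<epsilon> k" using assms tau_le_Suc_excess[of k] by simp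
  then show thesis
    using that[of "seed_start 3 k + j"] seed_square[of j k "seed_start 3 k + j" 3 "\<tau> k"]
      first_seeds(5,6,7)[of k] False
    by (simp add: single_end_def single_root_def late_end_def)
qed

lemma double_root_square:
  assumes "j \<le> \<epsilon> n" "p = \<tau> (n + 1) + \<tau> n"
  obtains s where "s + 2 * p = double_end n j" "agree s (s + p) p" "double_root n j = factor s p"
  using that[of "\<tau> (n + 2) + j"] seed_square[of j n "\<tau> (n + 2) + j" 1 p] first_seeds(3,4)[of n] assms
  by (simp add: double_end_def double_root_def)

lemma length_single_root [simp]: "length (single_root k j) = \<tau> k"
  and length_double_root [simp]: "length (double_root n j) = \<tau> (n + 1) + \<tau> n"
  by (simp_all add: single_root_def double_root_def)

definition single_indices :: "nat \<Rightarrow> (nat \<times> nat) set" where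
  "single_indices n = {(k, j). j < \<tau> k \<and> single_end k j \<le> n}"

definition double_indices :: "nat \<Rightarrow> (nat \<times> nat) set" where
  "double_indices n = {(m, j). j \<le> \<epsilon> m \<and> double_end m j \<le> n}"

text \<open>A given square belongs to some seed; moving it to the first seed with the same letter, and for \<open>c\<close>
  reducing the number of rotations modulo the period, never moves its end to the right.\<close>

theorem squares_in_prefix:
  "{\<omega>. \<omega> \<noteq> [] \<and> sublist (\<omega> @ \<omega>) (stake n tribonacci_word)}
    = (\<lambda>(k, j). single_root k j) ` single_indices n \<union> (\<lambda>(m, j). double_root m j) ` double_indices n"
  (is "?S = ?A \<union> ?B")
proof (intro equalityI subsetI)
  fix \<omega> assume "\<omega> \<in> ?S"
  then obtain s where "\<omega> \<noteq> []" and s: "s + 2 * length \<omega> \<le> n"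
    and sq: "agree s (s + length \<omega>) (length \<omega> + 0)" and w: "\<omega> = factor s (length \<omega>)"
    unfolding square_in_prefix_iff by auto
  define p where "p = length \<omega>"
  obtain i m j where p: "p = seed_period i m" and s': "s = seed_start i m + j" and j: "j \<le> \<epsilon> m"
    using square_from_seed[OF sq] \<open>\<omega> \<noteq> []\<close> by (auto simp: p_def)
  have w': "\<omega> = rotate j (factor (seed_start i m) (seed_period i m))"
    using seed_square(2)[OF j s' p] w p by (simp add: p_def)
  note bound = s[folded p_def]
  show "\<omega> \<in> ?A \<union> ?B"
  proof (cases "T i")
    case La
    have eq: "T i = T 0" using La T_initial by simp
    have "\<omega> = single_root (m + 3) j" "p = \<tau> (m + 3)"
      using w' p seed_word_eq[OF eq, of m] first_seeds(1,2)[of m] by (simp_all add: single_root_def)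
    moreover have "\<epsilon> m < \<tau> (m + 3)"
      using excess_tau[of m] tau_less_iff[of "Suc (Suc m)" "m + 3"] by linarith
    then have "(m + 3, j) \<in> single_indices n"
      using j bound s' \<open>p = \<tau> (m + 3)\<close> by (simp add: single_indices_def single_end_def early_count_def)
    ultimately show ?thesis by force
  next
    case Lb
    have eq: "T i = T 1" using Lb T_initial by simp
    have "1 \<le> i" using Lb T_initial(1) by (cases "i = 0") auto
    then have "\<tau> (m + 2) \<le> seed_start i m"
      using seed_start_mono[OF eq, of m] first_seeds(3)[of m] by simp
    moreover have "\<omega> = double_root m j" "p = \<tau> (m + 1) + \<tau> m"
      using w' p seed_word_eq[OF eq, of m] first_seeds(3,4)[of m] by (simp_all add: double_root_def)
    ultimately have "(m, j) \<in> double_indices n"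
      using j bound s' by (simp add: double_indices_def double_end_def)
    then show ?thesis using \<open>\<omega> = double_root m j\<close> by force
  next
    case Lc
    have eq: "T i = T 3" using Lc T_initial by simp
    have "i \<noteq> 0" "i \<noteq> 1" "i \<noteq> 2" using Lc T_initial(1,2,3) by (metis letter.distinct)+
    then have "3 \<le> i" by linarith
    then have start: "\<tau> (m + 2) + \<tau> (m + 1) \<le> seed_start i m"
      using seed_start_mono[OF eq, of m] first_seeds(5)[of m] by simp
    have pm: "p = \<tau> m" and w3: "\<omega> = rotate j (factor 0 (\<tau> m))"
      using w' p seed_word_eq[OF eq, of m] first_seeds(6,7)[of m] by simp_all
    define j' where "j' = j mod \<tau> m"
    have "\<omega> = single_root m j'"
      using w3 rotate_conv_mod[of j "factor 0 (\<tau> m)"] by (simp add: single_root_def j'_def)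
    moreover have "j' < \<tau> m" "j' \<le> j"
      using tau_greater[of m] by (simp_all add: j'_def)
    then have "(m, j') \<in> single_indices n"
      using start bound s' pm by (simp add: single_indices_def single_end_def late_end_def)
    ultimately show ?thesis by force
  qed
next
  fix \<omega> assume "\<omega> \<in> ?A \<union> ?B"
  then show "\<omega> \<in> ?S"
  proof
    assume "\<omega> \<in> ?A"
    then obtain k j where kj: "j < \<tau> k" "single_end k j \<le> n" "\<omega> = single_root k j"
      by (auto simp: single_indices_def)
    obtain s where "s + 2 * \<tau> k = single_end k j" "agree s (s + \<tau> k) (\<tau> k)" "single_root k j = factor s (\<tau> k)"
      using single_root_square[OF kj(1)] .
    then show ?thesis using kj tau_greater[of k] unfolding square_in_prefix_iff
      by (auto intro!: exI[of _ s] dest: arg_cong[of _ _ length])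
  next
    assume "\<omega> \<in> ?B"
    then obtain m j where mj: "j \<le> \<epsilon> m" "double_end m j \<le> n" "\<omega> = double_root m j"
      by (auto simp: double_indices_def)
    define p where "p = \<tau> (m + 1) + \<tau> m"
    obtain s where "s + 2 * p = double_end m j" "agree s (s + p) p" "double_root m j = factor s p"
      using double_root_square[OF mj(1) p_def] .
    moreover have "length \<omega> = p" using mj by (simp add: p_def)
    ultimately show ?thesis using mj tau_greater[of m] unfolding square_in_prefix_iff
      by (auto intro!: exI[of _ s] simp: p_def dest: arg_cong[of _ _ length])
  qed
qed

lemma inj_on_single_root: "inj_on (\<lambda>(k, j). single_root k j) (single_indices n)"
proof (rule inj_onI, clarify)
  fix k j k' j'
  assume kj: "(k, j) \<in> single_indices n" "(k', j') \<in> single_indices n" and eq: "single_root k j = single_root k' j'"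
  have "\<tau> k = \<tau> k'" using arg_cong[OF eq, of length] by simp
  then have k: "k = k'" using strict_mono_eq[OF tau_strict_mono] by blast
  have "agree (seed_start 3 k) (seed_start 3 k + \<tau> k) (\<tau> k)"
    using seed_square(1)[of 0 k "seed_start 3 k" 3 "\<tau> k"] first_seeds(6)[of k] by simp
  then have "j = j'"
    using rotate_primitive_inject[of "seed_start 3 k" "\<tau> k" j j'] kj eq k first_seeds(7)[of k]
    by (simp add: single_indices_def single_root_def)
  then show "k = k' \<and> j = j'" using k by simp
qed

lemma inj_on_double_root: "inj_on (\<lambda>(m, j). double_root m j) (double_indices n)"
proof (rule inj_onI, clarify)
  fix m j m' j'
  assume mj: "(m, j) \<in> double_indices n" "(m', j') \<in> double_indices n" and eq: "double_root m j = double_root m' j'"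
  have lens: "\<tau> (m + 1) + \<tau> m = \<tau> (m' + 1) + \<tau> m'" using arg_cong[OF eq, of length] by simp
  have m: "m = m'"
  proof (rule linorder_cases)
    assume "m < m'"
    then show ?thesis using lens tau_less_iff[of m m'] tau_less_iff[of "m + 1" "m' + 1"] by linarith
  next
    assume "m' < m"
    then show ?thesis using lens tau_less_iff[of m' m] tau_less_iff[of "m' + 1" "m + 1"] by linarith
  qed
  define p where "p = \<tau> (m + 1) + \<tau> m"
  have "agree (\<tau> (m + 2)) (\<tau> (m + 2) + p) p"
    using seed_square(1)[of 0 m "seed_start 1 m" 1 p] first_seeds(3,4)[of m] by (simp add: p_def)
  moreover have "\<epsilon> m < p"
    using excess_less[of m] tau_less_iff[of m "m + 1"] unfolding p_def by linarith
  ultimately have "j = j'"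
    using rotate_primitive_inject[of "\<tau> (m + 2)" p j j'] mj eq m
    by (simp add: double_indices_def double_root_def p_def)
  then show "m = m' \<and> j = j'" using m by simp
qed

lemma single_root_neq_double_root: "single_root k j \<noteq> double_root m j'"
proof
  assume "single_root k j = double_root m j'"
  then have eq: "\<tau> k = \<tau> (m + 1) + \<tau> m" using length_single_root length_double_root by metis
  have "0 < \<tau> m" using tau_greater[of m] by simp
  then have "m + 1 < k" using eq tau_less_iff[of "m + 1" k] by linarith
  then have "\<tau> (m + 2) \<le> \<tau> k" by simp
  moreover have "\<tau> (m + 1) + \<tau> m < \<tau> (m + 2)"
  proof (cases m)
    case 0
    then show ?thesis by (simp add: tau_0 tau_1 tau_2)
  next
    case (Suc l)
    then show ?thesis using tau_greater[of l] by (simp add: tau_Suc3)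
  qed
  ultimately show False using eq by simp
qed

section \<open>Counting\<close>

lemma early_count_le_tau: "early_count k \<le> \<tau> k"
proof (cases "k < 3")
  case False
  then obtain m where k: "k = m + 3" by (metis add.commute le_Suc_ex not_less)
  have "\<tau> (Suc (Suc m)) < \<tau> k" using k by simp
  then have "Suc (\<epsilon> m) \<le> \<tau> k" using excess_tau[of m] by linarith
  then show ?thesis using k by (simp add: early_count_def)
qed (simp add: early_count_def)

text \<open>The early conjugates have ends starting from \<open>2 t\<^sub>k\<close>, the others from \<open>late_end k + early_count k\<close>; the truncated
  differences are zero as long as \<open>n\<close> is too small.\<close>

lemma card_indices:
  "card {j. j < \<tau> k \<and> single_end k j \<le> n}
    = min (early_count k) (Suc n - 2 * \<tau> k) + (min (\<tau> k) (Suc n - late_end k) - early_count k)"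
proof -
  note early_count_le_tau[of k]
  then have "{j. j < \<tau> k \<and> single_end k j \<le> n}
      = {..<min (early_count k) (Suc n - 2 * \<tau> k)} \<union> {early_count k..<min (\<tau> k) (Suc n - late_end k)}"
    by (auto simp: single_end_def)
  moreover have "{..<min (early_count k) (Suc n - 2 * \<tau> k)} \<inter>
      {early_count k..<min (\<tau> k) (Suc n - late_end k)} = {}" by auto
  ultimately show ?thesis by (simp add: card_Un_disjoint)
qed

lemma num_squares_eq_sum:
  assumes "n < 2 * \<tau> K" "n < double_end M 0"
  shows "num_squares n =
    (\<Sum>k<K. min (early_count k) (Suc n - 2 * \<tau> k) + (min (\<tau> k) (Suc n - late_end k) - early_count k))
    + (\<Sum>m<M. min (Suc (\<epsilon> m)) (Suc n - double_end m 0))"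
proof -
  have "k < K" if "j < \<tau> k" "single_end k j \<le> n" for k j
  proof (rule ccontr)
    assume "\<not> k < K"
    then have "2 * \<tau> K \<le> 2 * \<tau> k" by simp
    also have "\<dots> \<le> single_end k j" by (simp add: single_end_def late_end_def)
    finally show False using that assms by simp
  qed
  then have A: "single_indices n = (SIGMA k:{..<K}. {j. j < \<tau> k \<and> single_end k j \<le> n})"
    by (auto simp: single_indices_def)
  have "m < M" if "double_end m j \<le> n" for m j
  proof (rule ccontr)
    assume "\<not> m < M"
    then have "double_end M 0 \<le> double_end m j"
      unfolding double_end_def by (intro add_mono mult_le_mono2) simp_all
    then show False using that assms by simp
  qed
  then have B: "double_indices n = (SIGMA m:{..<M}. {j. j \<le> \<epsilon> m \<and> double_end m j \<le> n})"
    by (auto simp: double_indices_def)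
  have "{j. j \<le> \<epsilon> m \<and> double_end m j \<le> n} = {..<min (Suc (\<epsilon> m)) (Suc n - double_end m 0)}" for m
    by (auto simp: double_end_def)
  then have cardB: "card {j. j \<le> \<epsilon> m \<and> double_end m j \<le> n} = min (Suc (\<epsilon> m)) (Suc n - double_end m 0)" for m
    by simp
  have fin: "finite (single_indices n)" "finite (double_indices n)"
    unfolding A B by (auto intro!: finite_SigmaI)
  have "num_squares n = card (single_indices n) + card (double_indices n)"
    unfolding num_squares_def squares_in_prefix
    using fin single_root_neq_double_root
    by (subst card_Un_disjoint)
      (auto simp: card_image inj_on_single_root inj_on_double_root)
  then show ?thesis
    unfolding A B by (simp add: card_indices cardB)
qed


text \<open>This says \<open>late_end (k + 1) + early_count (k + 1) = 2 t\<^sub>k\<^sub>+\<^sub>3 + early_count (k + 3)\<close>: the late ends of the period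
  \<open>t\<^sub>k\<^sub>+\<^sub>1\<close> begin immediately after the early ends of the period \<open>t\<^sub>k\<^sub>+\<^sub>3\<close>.\<close>

lemma early_count_balance: "early_count (Suc k) + \<tau> (k + 2) + 2 * \<tau> (k + 1) = Suc (\<epsilon> k) + \<tau> (k + 3)"
proof -
  have t: "\<tau> 3 = 7" "\<tau> 4 = 13"
    using tau_Suc3[of 0] tau_Suc3[of 1] by (simp_all add: tau_0 tau_1 tau_2 eval_nat_numeral)
  show ?thesis
  proof (cases "k < 2")
    case True
    then consider "k = 0" | "k = 1" by linarith
    then show ?thesis
      using t tau_1 tau_2 excess_0 excess_Suc[of 0] tau_0
      by cases (simp_all add: early_count_def tau_Suc3 numeral_2_eq_2 numeral_3_eq_3)
  next
    case False
    then obtain m where k: "k = Suc (Suc m)" by (metis add_2_eq_Suc le_Suc_ex not_less)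
    then have "early_count (Suc k) = Suc (\<epsilon> m)" by (simp add: early_count_def)
    moreover have "\<tau> (k + 3) = \<tau> (k + 2) + \<tau> (k + 1) + \<tau> k" "\<tau> (k + 1) = \<tau> k + \<tau> (Suc m) + \<tau> m"
      using tau_Suc3[of k] tau_Suc3[of m] k by (simp_all add: eval_nat_numeral)
    moreover have "\<epsilon> k = \<tau> (Suc m) + (\<tau> m + \<epsilon> m)" using k by (simp add: excess_Suc)
    ultimately show ?thesis by linarith
  qed
qed

lemma sum_tau: "(\<Sum>k<n. \<tau> k) = \<epsilon> n"
  by (induction n) (simp_all add: excess_0 excess_Suc)

lemma sum_Suc_excess: "2 * (\<Sum>m<n. Suc (\<epsilon> m)) + n + 3 = \<tau> (n + 1) + \<tau> n"
proof (induction n)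
  case (Suc n)
  then show ?case using excess_tau[of n] by simp
qed (simp add: tau_0 tau_1)

text \<open>Here \<open>m = K + 4\<close>. Below \<open>\<alpha>\<^sub>m\<close> all squares with period at most \<open>t\<^sub>m\<^sub>-\<^sub>4\<close> or \<open>t\<^sub>m\<^sub>-\<^sub>3 + t\<^sub>m\<^sub>-\<^sub>4\<close> have
  occurred, and the early ones with period \<open>t\<^sub>m\<^sub>-\<^sub>3\<close> and \<open>t\<^sub>m\<^sub>-\<^sub>2\<close>. The three remaining terms depend on \<open>n\<close>.\<close>

lemma num_squares_window:
  assumes "2 * \<tau> (K + 3) \<le> n" "n < 2 * \<tau> (K + 4)"
  shows "num_squares n = \<epsilon> (K + 1) + early_count (K + 1) + early_count (K + 2)
    + (min (\<tau> (K + 1)) (Suc n - late_end (K + 1)) - early_count (K + 1))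
    + min (Suc (\<epsilon> K)) (Suc n - 2 * \<tau> (K + 3))
    + (\<Sum>m<K + 1. Suc (\<epsilon> m)) + min (Suc (\<epsilon> (K + 1))) (Suc n - double_end (K + 1) 0)"
proof -
  define cA where "cA k = min (early_count k) (Suc n - 2 * \<tau> k)
    + (min (\<tau> k) (Suc n - late_end k) - early_count k)" for k
  define cB where "cB m = min (Suc (\<epsilon> m)) (Suc n - double_end m 0)" for m
  have c: "\<tau> (K + 3) = \<tau> (K + 2) + \<tau> (K + 1) + \<tau> K"
    and d: "\<tau> (K + 4) = \<tau> (K + 3) + \<tau> (K + 2) + \<tau> (K + 1)"
    and e: "\<tau> (K + 5) = \<tau> (K + 4) + \<tau> (K + 3) + \<tau> (K + 2)"
    using tau_Suc3[of K] tau_Suc3[of "K + 1"] tau_Suc3[of "K + 2"]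
    by (simp_all add: eval_nat_numeral)
  have pos: "0 < \<tau> K" using tau_greater[of K] by simp
  have mono: "\<tau> k \<le> \<tau> l" if "k \<le> l" for k l using that by simp
  have C1: "late_end (K + 1) = \<tau> (K + 3) + \<tau> (K + 2) + 2 * \<tau> (K + 1)"
    and C2: "late_end (K + 2) = \<tau> (K + 4) + \<tau> (K + 3) + 2 * \<tau> (K + 2)"
    and C3: "late_end (K + 3) = \<tau> (K + 5) + \<tau> (K + 4) + 2 * \<tau> (K + 3)"
    by (simp_all add: late_end_def eval_nat_numeral)
  have sumA: "(\<Sum>k<K + 4. cA k) = (\<Sum>k<K + 1. cA k) + cA (K + 1) + cA (K + 2) + cA (K + 3)"
    by (simp add: eval_nat_numeral)
  have sumB: "(\<Sum>m<K + 2. cB m) = (\<Sum>m<K + 1. cB m) + cB (K + 1)"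
    by simp
  have "cA k = \<tau> k" if "k < K + 1" for k
  proof -
    have "\<tau> (k + 1) \<le> \<tau> (K + 1)" "\<tau> (k + 2) \<le> \<tau> (K + 2)" "\<tau> k \<le> \<tau> K"
      using mono that by simp_all
    moreover have "\<tau> K \<le> \<tau> (K + 2)" by simp
    ultimately have "late_end k + \<tau> k \<le> n" "2 * \<tau> k + \<tau> k \<le> n"
      using assms(1) c unfolding late_end_def by linarith+
    then have "min (early_count k) (Suc n - 2 * \<tau> k) = early_count k" "min (\<tau> k) (Suc n - late_end k) = \<tau> k"
      using early_count_le_tau[of k] by (simp_all add: min_absorb1)
    then show ?thesis using early_count_le_tau[of k] by (simp add: cA_def)
  qed
  then have A0: "(\<Sum>k<K + 1. cA k) = \<epsilon> (K + 1)"
    using sum_tau[of "K + 1"] by simp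
  have A1: "cA (K + 1) = early_count (K + 1) + (min (\<tau> (K + 1)) (Suc n - late_end (K + 1)) - early_count (K + 1))"
  proof -
    have "early_count (K + 1) \<le> Suc n - 2 * \<tau> (K + 1)"
    proof -
      have "\<tau> (K + 1) \<le> \<tau> (K + 2)" by simp
      then show ?thesis using early_count_le_tau[of "K + 1"] assms(1) c by linarith
    qed
    then show ?thesis by (simp add: cA_def min_absorb1)
  qed
  have balance: "early_count (K + 2) + \<tau> (K + 3) + 2 * \<tau> (K + 2) = Suc (\<epsilon> (K + 1)) + \<tau> (K + 4)"
    "2 * \<epsilon> (K + 1) + 3 + \<tau> (K + 1) = \<tau> (K + 3)"
    using early_count_balance[of "K + 1"] excess_tau[of "K + 1"] by (simp_all add: eval_nat_numeral)
  then have "n < late_end (K + 2) + early_count (K + 2)"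
    using assms(2) C2 by linarith
  moreover have "early_count (K + 2) \<le> Suc n - 2 * \<tau> (K + 2)"
    using balance assms(1) c d pos by linarith
  ultimately have A2: "cA (K + 2) = early_count (K + 2)"
    by (simp add: cA_def min_absorb1)
  have A3: "cA (K + 3) = min (Suc (\<epsilon> K)) (Suc n - 2 * \<tau> (K + 3))"
    using assms(2) C3 e by (simp add: cA_def early_count_def)
  have "cB m = Suc (\<epsilon> m)" if "m < K + 1" for m
  proof -
    have "\<epsilon> m \<le> \<tau> (m + 2)" using excess_tau[of m] by simp
    also have "\<dots> \<le> \<tau> (K + 2)" using that by simp
    finally have "double_end m 0 + \<epsilon> m \<le> \<tau> (K + 2) + 2 * (\<tau> (K + 1) + \<tau> K) + 0 + \<tau> (K + 2)"
      unfolding double_end_def using that by (intro add_mono mult_le_mono2) simp_all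
    then have "double_end m 0 + \<epsilon> m \<le> n"
      using assms(1) c by simp
    then show ?thesis by (simp add: cB_def)
  qed
  then have B0: "(\<Sum>m<K + 1. cB m) = (\<Sum>m<K + 1. Suc (\<epsilon> m))" by simp
  have "n < double_end (K + 2) 0"
    using assms(2) c d pos by (simp add: double_end_def eval_nat_numeral)
  then have "num_squares n = (\<Sum>k<K + 4. cA k) + (\<Sum>m<K + 2. cB m)"
    using num_squares_eq_sum[OF assms(2)] unfolding cA_def cB_def by blast
  then show ?thesis
    unfolding sumA sumB A0 A1 A2 A3 B0 by (simp add: cB_def)
qed

lemma num_squares_small:
  assumes "n < 14"
  shows "num_squares n = (if n < 8 then 0 else if n < 10 then 1 else 2)"
proof -
  have t: "\<tau> 3 = 7" "\<tau> 4 = 13"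
    using tau_Suc3[of 0] tau_Suc3[of 1] by (simp_all add: tau_0 tau_1 tau_2 eval_nat_numeral)
  have "n < 2 * \<tau> 3" "n < double_end 1 0"
    using assms t tau_1 tau_2 by (simp_all add: double_end_def numeral_3_eq_3 numeral_2_eq_2)
  note sum = num_squares_eq_sum[OF this]
  have t': "\<tau> 1 = 2" "\<tau> 2 = 4" using tau_1 tau_2 by (simp_all add: numeral_2_eq_2)
  have three: "(\<Sum>k<3. f k) = f 0 + f 1 + f 2" for f :: "nat \<Rightarrow> nat"
    by (simp add: numeral_3_eq_3 numeral_2_eq_2)
  have one: "(\<Sum>k<1. f k) = f 0" for f :: "nat \<Rightarrow> nat"
    by simp
  have base: "late_end 0 = 8" "late_end 1 = 15" "late_end 2 = 28" "double_end 0 0 = 10"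
    unfolding late_end_def double_end_def using t t' tau_0
    by (simp_all add: tau_1 tau_2 tau_Suc3)
  have early0: "early_count 0 = 0" "early_count 1 = 0" "early_count 2 = 0" by (simp_all add: early_count_def)
  have *: "num_squares n = min 1 (Suc n - 8) + min 1 (Suc n - 10)"
    using sum[unfolded three one base early0 excess_0 tau_0 t'] assms by simp
  consider "n < 8" | "8 \<le> n" "n < 10" | "10 \<le> n" by linarith
  then show ?thesis by cases (simp_all add: *)
qed

lemma trib_eq_tau: "trib (int k) = int (\<tau> k)"
proof (induction k rule: less_induct)
  case (less k)
  consider "k = 0" | "k = Suc 0" | "k = Suc (Suc 0)" | m where "k = Suc (Suc (Suc m))"
    by (metis not0_implies_Suc)
  then show ?case
  proof cases
    case 4
    have "trib (int k) = trib (int (m + 2)) + trib (int (m + 1)) + trib (int m)"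
      using trib_rec(4)[of "int k"] 4 by (simp add: algebra_simps)
    then show ?thesis using 4 less.IH[of "m + 2"] less.IH[of "m + 1"] less.IH[of m]
      by (simp add: tau_Suc3)
  next
    case 2
    then show ?thesis using trib_rec(4)[of 1] trib_rec(1-3) by (simp add: tau_1)
  next
    case 3
    then show ?thesis using trib_rec(4)[of 1] trib_rec(4)[of 2] trib_rec(1-3) by (simp add: tau_2)
  qed (simp add: trib_rec tau_0)
qed

lemma num_squares_formula:
  fixes K n :: nat and m :: int
  assumes m: "m = int K + 4" and n: "2 * trib (m - 1) \<le> int n" "int n < 2 * trib m"
  shows "trib_alpha m \<le> real n \<and> real n < trib_beta m \<longrightarrow>
      real (num_squares n) = real n - (trib m + trib (m - 3) + m + 3) / 2"
    and "trib_beta m \<le> real n \<and> real n < trib_gamma m \<longrightarrow>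
      real (num_squares n) = (trib (m - 1) + trib (m - 2) + 4 * trib (m - 3) - m - 5) / 2"
    and "trib_gamma m \<le> real n \<and> real n < trib_theta m \<longrightarrow>
      real (num_squares n) = real n - (trib (m - 1) + 3 * trib (m - 2) + m + 3) / 2"
    and "trib_theta m \<le> real n \<and> real n < trib_alpha (m + 1) \<longrightarrow>
      real (num_squares n) = (2 * trib (m - 1) + trib (m - 2) + 3 * trib (m - 3) - m - 6) / 2"
proof -
  have t: "trib (m - 3) = int (\<tau> (K + 1))" "trib (m - 2) = int (\<tau> (K + 2))"
    "trib (m - 1) = int (\<tau> (K + 3))" "trib m = int (\<tau> (K + 4))"
    using trib_eq_tau[of "K + 1"] trib_eq_tau[of "K + 2"] trib_eq_tau[of "K + 3"]
      trib_eq_tau[of "K + 4"] m by (simp_all add: algebra_simps)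
  define z a b c d e0 e1 h1 h2 S where "z = \<tau> K" and "a = \<tau> (K + 1)" and "b = \<tau> (K + 2)"
    and "c = \<tau> (K + 3)" and "d = \<tau> (K + 4)" and "e0 = \<epsilon> K" and "e1 = \<epsilon> (K + 1)"
    and "h1 = early_count (K + 1)" and "h2 = early_count (K + 2)" and "S = (\<Sum>m<K + 1. Suc (\<epsilon> m))"
  have rel: "c = b + a + z" "d = c + b + a" "2 * e0 + 3 + z = b" "2 * e1 + 3 + a = c"
    "h1 + b + 2 * a = Suc e0 + c" "h2 + c + 2 * b = Suc e1 + d" "2 * S + K + 4 = b + a"
    using tau_Suc3[of K] tau_Suc3[of "K + 1"] excess_tau[of K] excess_tau[of "K + 1"]
      early_count_balance[of K] early_count_balance[of "K + 1"] sum_Suc_excess[of "K + 1"]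
    unfolding z_def a_def b_def c_def d_def e0_def e1_def h1_def h2_def S_def
    by (simp_all add: eval_nat_numeral)
  have h1: "h1 \<le> a" using early_count_le_tau[of "K + 1"] by (simp add: h1_def a_def)
  have window: "2 * c \<le> n" "n < 2 * d" using n t by (simp_all add: c_def d_def)
  have C: "late_end (K + 1) = c + b + 2 * a" "double_end (K + 1) 0 = c + 2 * (b + a)"
    by (simp_all add: late_end_def double_end_def a_def b_def c_def eval_nat_numeral)
  have A: "num_squares n = e1 + h1 + h2 + (min a (Suc n - (c + b + 2 * a)) - h1)
      + min (Suc e0) (Suc n - 2 * c) + S + min (Suc e1) (Suc n - (c + 2 * (b + a)))"
    using num_squares_window[of K n] window C
    unfolding a_def b_def c_def d_def e0_def e1_def h1_def h2_def S_def by simp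
  note defs = trib_alpha_def trib_beta_def trib_gamma_def trib_theta_def t[folded a_def b_def c_def d_def]
    arg_cong[OF m, of real_of_int, simplified]
  \<comment> \<open>The early ends with period \<open>c\<close> and the late ends with period \<open>a\<close> form one interval.\<close>
  have early_late: "min a (Suc n - C) - h1 + min (Suc e0) (Suc n - 2 * c)
      = min (Suc n) (C + a) - 2 * c" if "C + h1 = Suc e0 + 2 * c" for C
  proof (cases "Suc n \<le> Suc e0 + 2 * c")
    case True
    then have "Suc n - C \<le> h1" "min (Suc e0) (Suc n - 2 * c) = Suc n - 2 * c" "Suc n \<le> C + a"
      using that h1 by simp_all
    then show ?thesis by simp
  next
    case False
    then show ?thesis using that h1 by simp
  qed
  have C': "c + b + 2 * a + h1 = Suc e0 + 2 * c" and C'': "c + b + 2 * a + a = d + 2 * a"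
    using rel by linarith+
  have A': "num_squares n = e1 + h1 + h2 + (min (Suc n) (d + 2 * a) - 2 * c)
      + S + min (Suc e1) (Suc n - (c + 2 * (b + a)))"
    using A early_late[OF C'] C'' by simp
  have ab: "a \<le> b" "z \<le> a" "2 * c \<le> d + 2 * a"
  proof -
    show "a \<le> b" and za: "z \<le> a" by (simp_all add: z_def a_def b_def)
    show "2 * c \<le> d + 2 * a" using za rel by linarith
  qed
  have eq1: "2 * num_squares n + d + a + K + 7 = 2 * n" if "n + 1 < d + 2 * a"
  proof -
    have "min (Suc n) (d + 2 * a) = Suc n" "Suc n - (c + 2 * (b + a)) = 0"
      using that rel ab by simp_all
    then have "num_squares n = e1 + h1 + h2 + (Suc n - 2 * c) + S" using A' by simp
    then show ?thesis using rel window by linarith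
  qed
  have eq2: "2 * num_squares n + K + 9 = c + b + 4 * a" if "d + 2 * a \<le> n + 1" "n + c < 2 * d"
  proof -
    have "min (Suc n) (d + 2 * a) = d + 2 * a" "Suc n - (c + 2 * (b + a)) = 0"
      using that rel by simp_all
    then have "num_squares n = e1 + h1 + h2 + (d + 2 * a - 2 * c) + S" using A' by simp
    then show ?thesis using rel ab by linarith
  qed
  have eq3: "2 * num_squares n + c + 3 * b + K + 7 = 2 * n" if "2 * d \<le> n + c" "2 * n + 3 < 3 * d + b"
  proof -
    have "min (Suc n) (d + 2 * a) = d + 2 * a"
      "min (Suc e1) (Suc n - (c + 2 * (b + a))) = Suc n - (c + 2 * (b + a))"
      using that rel ab by simp_all
    then have "num_squares n = e1 + h1 + h2 + (d + 2 * a - 2 * c) + S + (Suc n - (c + 2 * (b + a)))"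
      using A' by simp
    moreover have "c + 2 * (b + a) \<le> Suc n" using that rel by simp
    ultimately have "num_squares n + 2 * c + c + 2 * (b + a) = e1 + h1 + h2 + d + 2 * a + S + Suc n"
      using ab by simp
    then have "2 * num_squares n + 6 * c + 4 * b + 4 * a = 2 * e1 + 2 * h1 + 2 * h2 + 2 * d + 4 * a + 2 * S + 2 * n + 2"
      by simp
    then show ?thesis using rel by linarith
  qed
  have eq4: "2 * num_squares n + K + 10 = 2 * c + b + 3 * a" if "3 * d + b \<le> 2 * n + 3"
  proof -
    have "min (Suc n) (d + 2 * a) = d + 2 * a"
      "min (Suc e1) (Suc n - (c + 2 * (b + a))) = Suc e1"
      using that rel ab by simp_all
    then have "num_squares n = e1 + h1 + h2 + (d + 2 * a - 2 * c) + S + Suc e1" using A' by simp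
    then show ?thesis using rel ab by linarith
  qed
  show "trib_alpha m \<le> real n \<and> real n < trib_beta m \<longrightarrow>
      real (num_squares n) = real n - (trib m + trib (m - 3) + m + 3) / 2"
  proof
    assume "trib_alpha m \<le> real n \<and> real n < trib_beta m"
    then have "real (n + 1) < real (d + 2 * a)" by (simp add: defs)
    then have "real (2 * num_squares n + d + a + K + 7) = real (2 * n)"
      using eq1 by (simp only: of_nat_less_iff)
    then show "real (num_squares n) = real n - (trib m + trib (m - 3) + m + 3) / 2"
      by (simp add: defs field_simps)
  qed
  show "trib_beta m \<le> real n \<and> real n < trib_gamma m \<longrightarrow>
      real (num_squares n) = (trib (m - 1) + trib (m - 2) + 4 * trib (m - 3) - m - 5) / 2"
  proof
    assume "trib_beta m \<le> real n \<and> real n < trib_gamma m"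
    then have "real (d + 2 * a) \<le> real (n + 1)" "real (n + c) < real (2 * d)" by (simp_all add: defs)
    then have "real (2 * num_squares n + K + 9) = real (c + b + 4 * a)"
      using eq2 by (simp only: of_nat_less_iff of_nat_le_iff)
    then show "real (num_squares n) = (trib (m - 1) + trib (m - 2) + 4 * trib (m - 3) - m - 5) / 2"
      by (simp add: defs field_simps)
  qed
  show "trib_gamma m \<le> real n \<and> real n < trib_theta m \<longrightarrow>
      real (num_squares n) = real n - (trib (m - 1) + 3 * trib (m - 2) + m + 3) / 2"
  proof
    assume "trib_gamma m \<le> real n \<and> real n < trib_theta m"
    then have "real (2 * d) \<le> real (n + c)" "real (2 * n + 3) < real (3 * d + b)" by (simp_all add: defs)
    then have "real (2 * num_squares n + c + 3 * b + K + 7) = real (2 * n)"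
      using eq3 by (simp only: of_nat_less_iff of_nat_le_iff)
    then show "real (num_squares n) = real n - (trib (m - 1) + 3 * trib (m - 2) + m + 3) / 2"
      by (simp add: defs field_simps)
  qed
  show "trib_theta m \<le> real n \<and> real n < trib_alpha (m + 1) \<longrightarrow>
      real (num_squares n) = (2 * trib (m - 1) + trib (m - 2) + 3 * trib (m - 3) - m - 6) / 2"
  proof
    assume "trib_theta m \<le> real n \<and> real n < trib_alpha (m + 1)"
    then have "real (3 * d + b) \<le> real (2 * n + 3)" by (simp add: defs)
    then have "real (2 * num_squares n + K + 10) = real (2 * c + b + 3 * a)"
      using eq4 by (simp only: of_nat_less_iff of_nat_le_iff)
    then show "real (num_squares n) = (2 * trib (m - 1) + trib (m - 2) + 3 * trib (m - 3) - m - 6) / 2"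
      by (simp add: defs field_simps)
  qed
qed

theorem theorem4p2:
  fixes n :: nat
  shows "(n \<le> 7 \<longrightarrow> num_squares n = 0)
    \<and> (n = 8 \<or> n = 9 \<longrightarrow> num_squares n = 1)
    \<and> (10 \<le> n \<and> n \<le> 13 \<longrightarrow> num_squares n = 2)
    \<and> (n \<ge> 14 \<longrightarrow>
        (\<exists>!m::int. m \<ge> -1 \<and> 2 * trib (m - 1) \<le> int n \<and> int n < 2 * trib m)
        \<and> (\<forall>m::int. m \<ge> -1 \<and> 2 * trib (m - 1) \<le> int n \<and> int n < 2 * trib m \<longrightarrow>
            m \<ge> 4
            \<and> (trib_alpha m \<le> real n \<and> real n < trib_beta m \<longrightarrow>
                real (num_squares n)
                  = real n - (trib m + trib (m - 3) + m + 3) / 2)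
            \<and> (trib_beta m \<le> real n \<and> real n < trib_gamma m \<longrightarrow>
                real (num_squares n)
                  = (trib (m - 1) + trib (m - 2) + 4 * trib (m - 3) - m - 5) / 2)
            \<and> (trib_gamma m \<le> real n \<and> real n < trib_theta m \<longrightarrow>
                real (num_squares n)
                  = real n - (trib (m - 1) + 3 * trib (m - 2) + m + 3) / 2)
            \<and> (trib_theta m \<le> real n \<and> real n < trib_alpha (m + 1) \<longrightarrow>
                real (num_squares n)
                  = (2 * trib (m - 1) + trib (m - 2) + 3 * trib (m - 3) - m - 6) / 2)))"
proof -
  let ?W = "\<lambda>m::int. m \<ge> -1 \<and> 2 * trib (m - 1) \<le> int n \<and> int n < 2 * trib m"
  have t3: "\<tau> 3 = 7" using tau_Suc3[of 0] by (simp add: tau_0 tau_1 tau_2 numeral_3_eq_3)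
  have window: "\<exists>K. m = int K + 4 \<and> 2 * \<tau> (K + 3) \<le> n \<and> n < 2 * \<tau> (K + 4)"
    if n: "14 \<le> n" and W: "?W m" for m
  proof -
    have "m \<noteq> -1" using n W trib_rec(2) by auto
    then obtain k where k: "m = int k" using W zero_le_imp_eq_int[of m] by auto
    then have "\<tau> 3 < \<tau> k" using n W t3 trib_eq_tau[of k] by simp
    then have "4 \<le> k" by simp
    then obtain K where K: "k = K + 4" by (metis add.commute le_Suc_ex)
    have "m - 1 = int (K + 3)" "m = int (K + 4)" using k K by simp_all
    then have "trib (m - 1) = int (\<tau> (K + 3))" "trib m = int (\<tau> (K + 4))"
      by (simp_all only: trib_eq_tau)
    then show ?thesis using W k K by (intro exI[of _ K]) simp
  qed
  have ex: "\<exists>m. ?W m" if "14 \<le> n"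
  proof -
    define k where "k = (LEAST k. n < 2 * \<tau> k)"
    have "n < 2 * \<tau> n" using tau_greater[of n] by simp
    then have k: "n < 2 * \<tau> k" unfolding k_def by (rule LeastI)
    have "k \<noteq> 0" using k that tau_0 by (cases "k = 0") auto
    then obtain l where l: "k = Suc l" by (cases k) auto
    then have "\<not> n < 2 * \<tau> l" using not_less_Least[of l "\<lambda>k. n < 2 * \<tau> k"] by (simp add: k_def)
    then show ?thesis using k l trib_eq_tau[of k] trib_eq_tau[of l]
      by (intro exI[of _ "int k"]) simp
  qed
  have unique: "m = m'" if n: "14 \<le> n" and W: "?W m" "?W m'" for m m'
  proof -
    obtain K where K: "m = int K + 4" "2 * \<tau> (K + 3) \<le> n" "n < 2 * \<tau> (K + 4)"
      using window[OF n W(1)] by blast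
    obtain K' where K': "m' = int K' + 4" "2 * \<tau> (K' + 3) \<le> n" "n < 2 * \<tau> (K' + 4)"
      using window[OF n W(2)] by blast
    have "\<tau> (K + 3) < \<tau> (K' + 4)" "\<tau> (K' + 3) < \<tau> (K + 4)" using K K' by linarith+
    then have "K + 3 < K' + 4" "K' + 3 < K + 4" by (simp_all only: tau_less_iff)
    then show ?thesis using K(1) K'(1) by simp
  qed
  have "m \<ge> 4
      \<and> (trib_alpha m \<le> real n \<and> real n < trib_beta m \<longrightarrow>
          real (num_squares n) = real n - (trib m + trib (m - 3) + m + 3) / 2)
      \<and> (trib_beta m \<le> real n \<and> real n < trib_gamma m \<longrightarrow>
          real (num_squares n) = (trib (m - 1) + trib (m - 2) + 4 * trib (m - 3) - m - 5) / 2)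
      \<and> (trib_gamma m \<le> real n \<and> real n < trib_theta m \<longrightarrow>
          real (num_squares n) = real n - (trib (m - 1) + 3 * trib (m - 2) + m + 3) / 2)
      \<and> (trib_theta m \<le> real n \<and> real n < trib_alpha (m + 1) \<longrightarrow>
          real (num_squares n) = (2 * trib (m - 1) + trib (m - 2) + 3 * trib (m - 3) - m - 6) / 2)"
    if n: "14 \<le> n" and W: "?W m" for m
  proof -
    obtain K where K: "m = int K + 4" using window[OF n W] by blast
    have "2 * trib (m - 1) \<le> int n" "int n < 2 * trib m" using W by simp_all
    note num_squares_formula[OF K this]
    moreover have "m \<ge> 4" using K by simp
    ultimately show ?thesis by blast
  qed
  moreover have "\<exists>!m. ?W m" if "14 \<le> n"
    using ex[OF that] unique[OF that] by blast
  moreover have "n \<le> 7 \<longrightarrow> num_squares n = 0" "n = 8 \<or> n = 9 \<longrightarrow> num_squares n = 1"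
    "10 \<le> n \<and> n \<le> 13 \<longrightarrow> num_squares n = 2"
    using num_squares_small[of n] by auto
  ultimately show ?thesis by blast
qed

end
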